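(* Let $m\geq 1$ be an integer, $0<\alpha<2$, and let $n$ be a positive integer with $2m+\alpha<n$. Let $a\geq 0$ and $0<p<\frac{n+2m+\alpha+2a}{n-2m-\alpha}$. Suppose $u\in C(\mathbb{R}^n)$ is a nonnegative solution of the integral equation $$u(x)=\int_{\mathbb{R}^n}\frac{R_{2m+\alpha,n}}{|x-y|^{n-2m-\alpha}}\,|y|^a u^p(y)\,dy,\qquad x\in\mathbb{R}^n.$$ Then $u\equiv 0$ in $\mathbb{R}^n$.
   Context: $R_{\gamma,n}:=\frac{\Gamma(\frac{n-\gamma}{2})}{\pi^{\frac n2}2^{\gamma}\Gamma(\frac\gamma2)}$ for $0<\gamma<n$ (the Riesz potential constant). The integral equation is required to hold for every $x\in\mathbb{R}^n$ (in particular the integral is finite). *)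

theory Defs
  imports "HOL-Analysis.Analysis"
begin

definition riesz_const :: "real \<Rightarrow> nat \<Rightarrow> real" where
  "riesz_const \<gamma> n =
     Gamma ((real n - \<gamma>) / 2) / (pi powr (real n / 2) * 2 powr \<gamma> * Gamma (\<gamma> / 2))"

text \<open>The integral is a Lebesgue integral, required to exist (and hence to be finite) at every
  \<open>x\<close>.  The conventions \<open>0 powr 0 = 0\<close> and \<open>t / 0 = 0\<close> affect the integrand only on the null
  set \<open>{0, x}\<close>; for \<open>p > 0\<close>, \<open>u y powr p\<close> is the usual power also where \<open>u y = 0\<close>.\<close>

definition riesz_integral_solution ::
    "real \<Rightarrow> real \<Rightarrow> real \<Rightarrow> (real ^ 'n::finite \<Rightarrow> real) \<Rightarrow> bool" where
  "riesz_integral_solution \<gamma> a p u \<longleftrightarrow>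
     (\<forall>x. has_bochner_integral lborel
        (\<lambda>y. riesz_const \<gamma> CARD('n) / norm (x - y) powr (real CARD('n) - \<gamma>)
              * (norm y powr a * u y powr p))
        (u x))"

end

(*
  Moving spheres centred at the origin, carried out on the integral equation alone. Let
  q = n - 2m - \<alpha> and let v_l(x) = (l/|x|)^q u(l^2 x/|x|^2) be the Kelvin transform. Inverting the part of
  the integral outside the ball B_l gives, for x in B_l,
     v_l(x) - u(x) = int_{B_l} (K(x,z) - P(x,z)) |z|^a ((l/|z|)^\<tau> v_l(z)^p - u(z)^p) dz
  with K > P >= 0, and \<tau> > 0 exactly because p is subcritical. For p >= 1, u <= v_l on B_l as soon as the
  set where it fails has small measure (the kernel has uniformly small integrals over small sets). That
  set is small for small l; moreover u <= v_l self-improves to u < v_l, so by dominated convergence it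
  stays small for l near any good l. Hence all l > 0 are good, which yields u(z) >= c |z|^(-q/2) at
  infinity. For p <= 1 the trivial bound u(z) >= c |z|^(-q) suffices. Inserting u >= c |z|^(-\<mu>) in the equation
  gives the exponent p \<mu> - a - 2m - \<alpha>, which is smaller by a fixed amount; after finitely many steps it is
  negative, and then the integral defining u(0) is infinite.
*)
theory Submission
  imports Defs
begin

subsection \<open>Inversion in a sphere\<close>

definition sphere_inv :: "real \<Rightarrow> 'a::real_inner \<Rightarrow> 'a" where
  "sphere_inv l x = (l / norm x)\<^sup>2 *\<^sub>R x"

lemma norm_sphere_inv: "norm (sphere_inv l x) = l\<^sup>2 / norm x"
  by (simp add: sphere_inv_def power2_eq_square)

lemma sphere_inv_eq_0_iff: "l \<noteq> 0 \<Longrightarrow> sphere_inv l x = 0 \<longleftrightarrow> x = 0"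
  by (simp add: sphere_inv_def)

lemma sphere_inv_involution:
  assumes "l \<noteq> 0" "x \<noteq> 0"
  shows "sphere_inv l (sphere_inv l x) = x"
  using assms
  by (simp add: sphere_inv_def[of l "sphere_inv l x"] norm_sphere_inv)
     (simp add: sphere_inv_def power2_eq_square)

lemma sphere_inv_inj:
  assumes "l \<noteq> 0"
  shows "inj_on (sphere_inv l) (- {0})"
  by (rule inj_on_inverseI[of _ "sphere_inv l"]) (use assms in \<open>auto simp: sphere_inv_involution\<close>)

lemma norm_scaleR_diff_sq:
  fixes x y :: "'a::real_inner"
  shows "(norm (c *\<^sub>R x - d *\<^sub>R y))\<^sup>2 = c\<^sup>2 * (norm x)\<^sup>2 - 2 * c * d * (x \<bullet> y) + d\<^sup>2 * (norm y)\<^sup>2"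
  unfolding power2_norm_eq_inner
  by (simp add: inner_diff_left inner_diff_right inner_commute power2_eq_square)

lemma norm_sphere_inv_diff:
  fixes x y :: "'a::real_inner"
  assumes "x \<noteq> 0" "y \<noteq> 0"
  shows "norm (sphere_inv l x - sphere_inv l y) = l\<^sup>2 * norm (x - y) / (norm x * norm y)"
proof (rule power2_eq_imp_eq)
  have nz: "norm x \<noteq> 0" "norm y \<noteq> 0" using assms by auto
  have "(norm (sphere_inv l x - sphere_inv l y))\<^sup>2
      = (l / norm x)^4 * (norm x)\<^sup>2 - 2 * (l / norm x)\<^sup>2 * (l / norm y)\<^sup>2 * (x \<bullet> y) + (l / norm y)^4 * (norm y)\<^sup>2"
    unfolding sphere_inv_def norm_scaleR_diff_sq by simp
  also have "\<dots> = l^4 * ((norm x)\<^sup>2 - 2 * (x \<bullet> y) + (norm y)\<^sup>2) / ((norm x)\<^sup>2 * (norm y)\<^sup>2)"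
    using nz by (simp add: divide_simps) (simp add: algebra_simps eval_nat_numeral)
  also have "\<dots> = (l\<^sup>2 * norm (x - y) / (norm x * norm y))\<^sup>2"
    using norm_scaleR_diff_sq[of 1 x 1 y] by (simp add: power_divide power_mult_distrib)
  finally show "(norm (sphere_inv l x - sphere_inv l y))\<^sup>2 = (l\<^sup>2 * norm (x - y) / (norm x * norm y))\<^sup>2" .
qed auto

lemma norm_diff_sphere_inv:
  fixes x y :: "'a::real_inner"
  assumes "x \<noteq> 0" "y \<noteq> 0" "l \<noteq> 0"
  shows "norm (x - sphere_inv l y) = norm (sphere_inv l x - y) * norm x / norm y"
  using norm_sphere_inv_diff[of "sphere_inv l x" y l] assms
  by (simp add: sphere_inv_involution sphere_inv_eq_0_iff norm_sphere_inv field_simps)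

text \<open>The squares of the two sides differ by (l^2 - |x|^2)(l^2 - |y|^2), which is positive
  inside the sphere. This is what makes \<open>P\<close> smaller than \<open>K\<close>
  later.\<close>

lemma norm_sphere_inv_diff_gt:
  fixes x y :: "'a::real_inner"
  assumes "x \<noteq> 0" "norm x < l" "norm y < l"
  shows "l * norm (x - y) < norm x * norm (sphere_inv l x - y)"
proof -
  have "(norm x)\<^sup>2 * (norm (sphere_inv l x - y))\<^sup>2
      = (norm x)\<^sup>2 * ((l / norm x)^4 * (norm x)\<^sup>2 - 2 * (l / norm x)\<^sup>2 * (x \<bullet> y) + (norm y)\<^sup>2)"
    using norm_scaleR_diff_sq[of "(l / norm x)\<^sup>2" x 1 y] by (simp add: sphere_inv_def)
  also have "\<dots> = l^4 - 2 * l\<^sup>2 * (x \<bullet> y) + (norm x)\<^sup>2 * (norm y)\<^sup>2"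
    using assms(1) by (simp add: divide_simps) (simp add: algebra_simps eval_nat_numeral)
  also have "\<dots> - (l * norm (x - y))\<^sup>2 = (l\<^sup>2 - (norm x)\<^sup>2) * (l\<^sup>2 - (norm y)\<^sup>2)"
    using norm_scaleR_diff_sq[of 1 x 1 y]
    by (simp add: power_mult_distrib) (simp add: algebra_simps power4_eq_xxxx power2_eq_square)
  finally have "(norm x * norm (sphere_inv l x - y))\<^sup>2 - (l * norm (x - y))\<^sup>2
      = (l\<^sup>2 - (norm x)\<^sup>2) * (l\<^sup>2 - (norm y)\<^sup>2)"
    by (simp add: power_mult_distrib)
  moreover have "norm x ^ 2 < l ^ 2" "norm y ^ 2 < l ^ 2"
    using assms by (auto intro!: power_strict_mono)
  ultimately have "(l * norm (x - y))\<^sup>2 < (norm x * norm (sphere_inv l x - y))\<^sup>2"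
    by (smt (verit) mult_pos_pos)
  then show ?thesis
    by (rule power2_less_imp_less) simp
qed

lemma sphere_inv_image_ball:
  assumes "l > 0"
  shows "sphere_inv l ` (ball 0 l - {0}) = - cball (0::'a::real_inner) l"
proof (intro equalityI subsetI)
  fix y :: 'a assume "y \<in> sphere_inv l ` (ball 0 l - {0})"
  then show "y \<in> - cball 0 l"
    using assms by (auto simp: norm_sphere_inv field_simps power2_eq_square)
next
  fix y :: 'a assume y: "y \<in> - cball 0 l"
  then have "y \<noteq> 0" using assms by auto
  moreover have "sphere_inv l y \<in> ball 0 l - {0}"
    using assms y \<open>y \<noteq> 0\<close> by (auto simp: norm_sphere_inv sphere_inv_eq_0_iff field_simps power2_eq_square)
  ultimately show "y \<in> sphere_inv l ` (ball 0 l - {0})"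
    using assms by (metis imageI less_irrefl sphere_inv_involution)
qed

lemma borel_measurable_sphere_inv [measurable]:
  "sphere_inv l \<in> borel_measurable (borel :: 'a::euclidean_space measure)"
  unfolding sphere_inv_def by measurable

section \<open>Derivative and Jacobian of the inversion\<close>

text \<open>This is the reflection in the hyperplane orthogonal to x. The derivative of the
  inversion at x is (l/|x|)^2 times it, so the Jacobian is (l/|x|)^(2n) in absolute value.\<close>

lemma orthogonal_transformation_reflection:
  fixes x :: "'a::euclidean_space"
  assumes "x \<noteq> 0"
  shows "orthogonal_transformation (\<lambda>h. h - (2 * (x \<bullet> h) / (norm x)\<^sup>2) *\<^sub>R x)"
  unfolding orthogonal_transformation_def
proof safe
  show "linear (\<lambda>h. h - (2 * (x \<bullet> h) / (norm x)\<^sup>2) *\<^sub>R x)"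
    by (rule linearI) (auto simp: inner_add_right algebra_simps add_divide_distrib)
  fix v w
  show "(v - (2 * (x \<bullet> v) / (norm x)\<^sup>2) *\<^sub>R x) \<bullet> (w - (2 * (x \<bullet> w) / (norm x)\<^sup>2) *\<^sub>R x) = v \<bullet> w"
    using assms by (simp add: inner_diff_left inner_diff_right inner_commute power2_norm_eq_inner)
qed

lemma has_derivative_sphere_inv:
  fixes x :: "'a::real_inner"
  assumes "x \<noteq> 0"
  shows "(sphere_inv l has_derivative
     (\<lambda>h. (l / norm x)\<^sup>2 *\<^sub>R (h - (2 * (x \<bullet> h) / (norm x)\<^sup>2) *\<^sub>R x))) (at x)"
proof -
  \<comment> \<open>Written with the inner product of y with itself instead of the norm, the
    inversion is a quotient covered by the usual derivative rules.\<close>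
  have *: "((\<lambda>y. (l\<^sup>2 / (y \<bullet> y)) *\<^sub>R y) has_derivative
      (\<lambda>h. (l / norm x)\<^sup>2 *\<^sub>R (h - (2 * (x \<bullet> h) / (norm x)\<^sup>2) *\<^sub>R x))) (at x)"
    using assms
    apply (auto intro!: derivative_eq_intros simp: power2_norm_eq_inner)
    apply (rule ext)
    apply (simp add: algebra_simps power_divide power2_norm_eq_inner inner_commute divide_simps)
    done
  have "sphere_inv l = (\<lambda>y::'a. (l\<^sup>2 / (y \<bullet> y)) *\<^sub>R y)"
    by (auto simp: sphere_inv_def power_divide power2_norm_eq_inner)
  with * show ?thesis by simp
qed

lemma abs_det_scaleR_orthogonal:
  fixes f :: "real^'n \<Rightarrow> real^'n"
  assumes "orthogonal_transformation f"
  shows "\<bar>det (matrix (\<lambda>h. c *\<^sub>R f h))\<bar> = \<bar>c\<bar> ^ CARD('n)"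
proof -
  have lin: "linear f" "linear (\<lambda>h. c *\<^sub>R h)"
    using assms orthogonal_transformation_linear by auto
  have "matrix (\<lambda>h. c *\<^sub>R f h) = matrix (\<lambda>h. c *\<^sub>R h) ** matrix f"
    using matrix_compose[OF lin] by (simp add: o_def)
  then show ?thesis
    using assms by (simp add: det_mul abs_mult power_abs)
qed

subsection \<open>Inversion as a change of variables\<close>

text \<open>The change of variables theorem of the library asks for a well-ordered index type, so an
  arbitrary finite index type is replaced by a well-ordered copy of itself.\<close>

typedef 'n wo_copy = "UNIV :: 'n set" by simp

instance wo_copy :: (finite) finite
proof
  show "finite (UNIV :: 'a wo_copy set)"
    using finite_imageI[of "UNIV :: 'a set" Abs_wo_copy]
    by (simp add: type_definition.Abs_image[OF type_definition_wo_copy])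
qed

instantiation wo_copy :: (finite) wellorder
begin

text \<open>The order is pulled back from the naturals along the injection \<open>to_nat\<close>, so
  well-foundedness is inherited.\<close>

definition "x \<le> y \<longleftrightarrow> to_nat (Rep_wo_copy x) \<le> to_nat (Rep_wo_copy y)"

definition "x < y \<longleftrightarrow> to_nat (Rep_wo_copy x) < to_nat (Rep_wo_copy y)"

instance
proof
  fix x y :: "'a wo_copy"
  show "x \<le> y \<Longrightarrow> y \<le> x \<Longrightarrow> x = y"
    by (simp add: less_eq_wo_copy_def Rep_wo_copy_inject)
next
  fix P :: "'a wo_copy \<Rightarrow> bool" and a :: "'a wo_copy"
  assume step: "\<And>x. (\<And>y. y < x \<Longrightarrow> P y) \<Longrightarrow> P x"
  show "P a"
    by (induction a rule: measure_induct_rule[of "\<lambda>x. to_nat (Rep_wo_copy x)"])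
       (auto intro: step simp: less_wo_copy_def)
qed (auto simp: less_eq_wo_copy_def less_wo_copy_def)

end

lemma bij_Rep_wo_copy: "bij Rep_wo_copy"
  by (rule bij_betw_byWitness[of _ Abs_wo_copy]) (auto simp: Rep_wo_copy_inverse Abs_wo_copy_inverse)

lemma CARD_wo_copy: "CARD('n::finite wo_copy) = CARD('n)"
  using bij_betw_same_card[OF bij_Rep_wo_copy] .

definition to_wo_copy :: "real ^ 'n::finite \<Rightarrow> real ^ 'n wo_copy" where
  "to_wo_copy x = (\<chi> i. x $ Rep_wo_copy i)"

lemma inner_to_wo_copy [simp]: "to_wo_copy x \<bullet> to_wo_copy y = x \<bullet> y"
  unfolding to_wo_copy_def inner_vec_def
  using sum.reindex_bij_betw[OF bij_Rep_wo_copy, of "\<lambda>i. x $ i \<bullet> y $ i"] by simp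

lemma norm_to_wo_copy [simp]: "norm (to_wo_copy x) = norm x"
  by (simp add: norm_eq_sqrt_inner)

lemma to_wo_copy_scaleR: "to_wo_copy (c *\<^sub>R x) = c *\<^sub>R to_wo_copy x"
  by (simp add: to_wo_copy_def vec_eq_iff)

lemma to_wo_copy_sphere_inv: "to_wo_copy (sphere_inv l x) = sphere_inv l (to_wo_copy x)"
  by (simp add: sphere_inv_def to_wo_copy_scaleR)

lemma bij_to_wo_copy: "bij to_wo_copy"
proof (rule bij_betw_byWitness)
  show "\<forall>a\<in>UNIV. (\<chi> j. to_wo_copy a $ Abs_wo_copy j) = a"
    by (simp add: to_wo_copy_def vec_eq_iff Abs_wo_copy_inverse)
  show "\<forall>a\<in>UNIV. to_wo_copy (\<chi> j. a $ Abs_wo_copy j) = a"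
    by (simp add: to_wo_copy_def vec_eq_iff Rep_wo_copy_inverse)
qed auto

lemma linear_to_wo_copy: "linear to_wo_copy"
  by (rule linearI) (auto simp: to_wo_copy_def vec_eq_iff)

lemma borel_measurable_to_wo_copy [measurable]: "to_wo_copy \<in> borel_measurable borel"
  using linear_to_wo_copy
  by (intro borel_measurable_continuous_onI) (rule linear_continuous_on, simp add: linear_conv_bounded_linear)

text \<open>Lebesgue measure is determined by its values on boxes, and relabelling the coordinates
  only permutes the side lengths of a box.\<close>

lemma distr_to_wo_copy: "distr lborel borel to_wo_copy = (lborel :: (real ^ 'n::finite wo_copy) measure)"
proof (rule lborel_eqI[symmetric])
  fix l u :: "real ^ 'n wo_copy"
  assume le: "\<And>b. b \<in> Basis \<Longrightarrow> l \<bullet> b \<le> u \<bullet> b"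
  define l' u' :: "real ^ 'n" where "l' = (\<chi> j. l $ Abs_wo_copy j)" and "u' = (\<chi> j. u $ Abs_wo_copy j)"
  have le': "l $ i \<le> u $ i" for i
    using le[of "axis i 1"] by (simp add: inner_axis axis_in_Basis_iff)
  have "to_wo_copy x \<in> box l u \<longleftrightarrow> x \<in> box l' u'" for x
  proof -
    have "to_wo_copy x \<in> box l u \<longleftrightarrow> (\<forall>i. l $ i < x $ Rep_wo_copy i \<and> x $ Rep_wo_copy i < u $ i)"
      by (simp add: mem_box_cart to_wo_copy_def)
    also have "\<dots> \<longleftrightarrow> (\<forall>j. l $ Abs_wo_copy j < x $ j \<and> x $ j < u $ Abs_wo_copy j)"
      using bij_Rep_wo_copy Abs_wo_copy_inverse Rep_wo_copy_inverse by (metis UNIV_I)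
    finally show ?thesis by (simp add: mem_box_cart l'_def u'_def)
  qed
  then have "to_wo_copy -` box l u = box l' u'" by auto
  then have "emeasure (distr lborel borel to_wo_copy) (box l u) = emeasure lborel (box l' u')"
    by (simp add: emeasure_distr)
  also have "\<dots> = ennreal (\<Prod>b\<in>Basis. (u' - l') \<bullet> b)"
    by (rule emeasure_lborel_box) (auto simp: Basis_vec_def inner_axis l'_def u'_def le')
  also have "(\<Prod>b\<in>Basis. (u' - l') \<bullet> b) = (\<Prod>j\<in>UNIV. u' $ j - l' $ j)"
    by (simp add: Basis_vec_def prod.UNION_disjoint inner_axis axis_eq_axis)
  also have "\<dots> = (\<Prod>i\<in>UNIV. u $ i - l $ i)"
    using prod.reindex_bij_betw[OF bij_Rep_wo_copy, of "\<lambda>j. u' $ j - l' $ j"]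
    by (simp add: u'_def l'_def Rep_wo_copy_inverse)
  also have "\<dots> = (\<Prod>b\<in>Basis. (u - l) \<bullet> b)"
    by (simp add: Basis_vec_def prod.UNION_disjoint inner_axis axis_eq_axis)
  finally show "emeasure (distr lborel borel to_wo_copy) (box l u) = ennreal (\<Prod>b\<in>Basis. (u - l) \<bullet> b)" .
qed simp

lemma sphere_inv_change_of_variables:
  fixes g :: "real ^ 'n::{finite,wellorder} \<Rightarrow> real"
  assumes int: "integrable lborel g" and l: "l > 0"
  defines "h \<equiv> \<lambda>z. (l / norm z) ^ (2 * CARD('n)) * g (sphere_inv l z)"
  shows "set_integrable lborel (ball 0 l - {0}) h \<and>
    (LINT z:ball 0 l - {0}|lborel. h z) = (LINT y:- cball 0 l|lborel. g y)"
proof -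
  have [measurable]: "g \<in> borel_measurable borel"
    using int by (simp add: integrable_iff_bounded)
  have hm [measurable]: "h \<in> borel_measurable borel"
    unfolding h_def by measurable
  let ?B = "ball 0 l - {0} :: (real ^ 'n::_) set" and ?C = "- cball 0 l :: (real ^ 'n::_) set"
  have m [measurable]: "(\<lambda>z. indicator ?B z *\<^sub>R h z) \<in> borel_measurable borel"
      "(\<lambda>y. indicator ?C y *\<^sub>R g y) \<in> borel_measurable borel"
    by (intro borel_measurable_scaleR borel_measurable_indicator; simp add: hm)+
  \<comment> \<open>The change of variables theorem concerns vector-valued functions, so real values
    are carried into \<open>real ^ 1\<close> and back.\<close>
  let ?up = "\<lambda>t::real. t *\<^sub>R (1 :: real ^ 1)" and ?down = "\<lambda>v::real ^ 1. v $ 1"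
  let ?D = "\<lambda>z::real ^ 'n::_. (\<lambda>k. (l / norm z)\<^sup>2 *\<^sub>R (k - (2 * (z \<bullet> k) / (norm z)\<^sup>2) *\<^sub>R z))"
  have up: "bounded_linear ?up" and down: "bounded_linear ?down"
    by (auto intro: bounded_linear_scaleR_left bounded_linear_vec_nth)
  have der: "(sphere_inv l has_derivative ?D z) (at z within ?B)" if "z \<in> ?B" for z
    using has_derivative_at_withinI[OF has_derivative_sphere_inv] that by blast
  have inj: "inj_on (sphere_inv l) ?B"
    by (rule inj_on_subset[OF sphere_inv_inj]) (use l in auto)
  have det: "\<bar>det (matrix (?D z))\<bar> = (l / norm z) ^ (2 * CARD('n))" if "z \<in> ?B" for z
    using abs_det_scaleR_orthogonal[OF orthogonal_transformation_reflection[of z], of "(l / norm z)\<^sup>2"] that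
    by (simp add: power_mult)
  have "set_integrable lborel ?C g"
    unfolding set_integrable_def by (rule integrable_mult_indicator[OF _ int]) auto
  \<comment> \<open>Absolute integrability refers to the completed measure. For Borel functions
    integrals against \<open>lborel\<close> and its completion agree; the passage is reversed at the
    end.\<close>
  then have gC: "g absolutely_integrable_on ?C"
    unfolding set_integrable_def using m by (subst integrable_completion) (simp_all only: measurable_lborel2)
  have upC: "(?up \<circ> g) absolutely_integrable_on sphere_inv l ` ?B"
    using absolutely_integrable_linear[OF gC up] sphere_inv_image_ball[OF l] by metis
  have upint: "integral (sphere_inv l ` ?B) (?up \<circ> g) = ?up (integral ?C g)"
    using integral_linear[OF set_lebesgue_integral_eq_integral(1)[OF gC] up] sphere_inv_image_ball[OF l] by metis
  let ?F = "\<lambda>z. \<bar>det (matrix (?D z))\<bar> *\<^sub>R (?up \<circ> g) (sphere_inv l z)"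
  have F: "?F absolutely_integrable_on ?B \<and> integral ?B ?F = ?up (integral ?C g)"
    using has_absolute_integral_change_of_variables[of ?B "sphere_inv l" ?D "?up \<circ> g" "?up (integral ?C g)"]
      der inj upC upint by (simp add: fmeasurableD)
  have down_F: "(?down \<circ> ?F) z = h z" if "z \<in> ?B" for z
    using det[OF that] by (simp add: h_def)
  have hB: "h absolutely_integrable_on ?B"
    using absolutely_integrable_linear[OF conjunct1[OF F] down] down_F
    by (subst (asm) set_integrable_cong[OF refl refl]) auto
  have "integral ?B h = integral ?B (?down \<circ> ?F)"
    using down_F by (intro integral_cong) auto
  also have "\<dots> = integral ?C g"
    using integral_linear[OF set_lebesgue_integral_eq_integral(1)[OF conjunct1[OF F]] down] F by simp
  finally have eq: "integral ?B h = integral ?C g" .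
  have "set_integrable lborel ?B h"
    using hB unfolding set_integrable_def using m by (subst (asm) integrable_completion) (simp_all only: measurable_lborel2)
  moreover have "(LINT z:?B|lborel. h z) = integral ?B h"
    using set_lebesgue_integral_eq_integral(2)[OF hB]
    unfolding set_lebesgue_integral_def using m by (subst (asm) integral_completion) (simp_all only: measurable_lborel2)
  moreover have "(LINT y:?C|lborel. g y) = integral ?C g"
    using set_lebesgue_integral_eq_integral(2)[OF gC]
    unfolding set_lebesgue_integral_def using m by (subst (asm) integral_completion) (simp_all only: measurable_lborel2)
  ultimately show ?thesis using eq by simp
qed

text \<open>Relabelling the coordinates preserves Lebesgue measure and norms and commutes with the
  inversion, so the formula transfers from the well-ordered copy.\<close>

lemma LINT_sphere_inv:
  fixes g :: "real ^ 'n::finite \<Rightarrow> real"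
  assumes int: "integrable lborel g" and l: "l > 0"
  defines "h \<equiv> \<lambda>z. (l / norm z) ^ (2 * CARD('n)) * g (sphere_inv l z)"
  shows set_integrable_sphere_inv: "set_integrable lborel (ball 0 l - {0}) h"
    and "(LINT z:ball 0 l - {0}|lborel. h z) = (LINT y:- cball 0 l|lborel. g y)"
proof -
  have [measurable]: "g \<in> borel_measurable borel"
    using int by (simp add: integrable_iff_bounded)
  have [measurable]: "h \<in> borel_measurable borel"
    unfolding h_def by measurable
  define T where "T = inv (to_wo_copy :: real ^ 'n \<Rightarrow> _)"
  have T1 [simp]: "T (to_wo_copy x) = x" for x
    unfolding T_def by (rule inv_f_f[OF bij_is_inj[OF bij_to_wo_copy]])
  have T2 [simp]: "to_wo_copy (T y) = y" for y
    unfolding T_def by (rule surj_f_inv_f[OF bij_is_surj[OF bij_to_wo_copy]])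
  have "linear T"
  proof (rule linearI)
    show "T (x + y) = T x + T y" for x y
      using T1[of "T x + T y"] by (simp add: linear_add[OF linear_to_wo_copy])
    show "T (c *\<^sub>R x) = c *\<^sub>R T x" for c x
      using T1[of "c *\<^sub>R T x"] by (simp add: to_wo_copy_scaleR)
  qed
  then have [measurable]: "T \<in> borel_measurable borel"
    by (intro borel_measurable_continuous_onI) (rule linear_continuous_on, simp add: linear_conv_bounded_linear)
  have normT [simp]: "norm (T y) = norm y" for y
    using norm_to_wo_copy[of "T y"] by simp
  have invT: "sphere_inv l (T y) = T (sphere_inv l y)" for y
    by (metis T1 T2 to_wo_copy_sphere_inv)
  have T0: "T y = 0 \<longleftrightarrow> y = 0" for y
    using normT[of y] by (metis norm_eq_zero)
  have tr_int: "integrable lborel (\<lambda>y. k (T y)) \<longleftrightarrow> integrable lborel k"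
    and tr: "integral\<^sup>L lborel (\<lambda>y. k (T y)) = integral\<^sup>L lborel k"
    if [measurable]: "k \<in> borel_measurable borel" for k :: "real ^ 'n \<Rightarrow> real"
    using integrable_distr_eq[of to_wo_copy lborel borel "\<lambda>y. k (T y)"]
      integral_distr[of to_wo_copy lborel borel "\<lambda>y. k (T y)"]
    by (simp_all add: distr_to_wo_copy)
  have main: "set_integrable lborel (ball 0 l - {0}) (\<lambda>y. h (T y)) \<and>
    (LINT y:ball 0 l - {0}|lborel. h (T y)) = (LINT y:- cball 0 l|lborel. g (T y))"
    using sphere_inv_change_of_variables[of "\<lambda>y. g (T y)" l] int l tr_int[of g]
    by (simp add: h_def invT CARD_wo_copy)
  have ind: "indicator (ball 0 l - {0}) y = (indicator (ball 0 l - {0}) (T y) :: real)"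
      "indicator (- cball 0 l) y = (indicator (- cball 0 l) (T y) :: real)" for y
    by (auto simp: indicator_def T0)
  have k: "(\<lambda>x. indicator (ball 0 l - {0}) x *\<^sub>R h x) \<in> borel_measurable borel"
      "(\<lambda>x. indicator (- cball 0 l) x *\<^sub>R g x) \<in> borel_measurable borel"
    by (intro borel_measurable_scaleR borel_measurable_indicator; simp)+
  show "set_integrable lborel (ball 0 l - {0}) h"
    using main tr_int[OF k(1)] unfolding set_integrable_def ind by blast
  show "(LINT z:ball 0 l - {0}|lborel. h z) = (LINT y:- cball 0 l|lborel. g y)"
    using main tr[OF k(1)] tr[OF k(2)] unfolding set_lebesgue_integral_def ind by argo
qed

subsection \<open>Solutions of the integral equation\<close>

lemma lborel_translation:
  fixes g :: "'a::euclidean_space \<Rightarrow> real"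
  assumes [measurable]: "g \<in> borel_measurable borel"
  shows integrable_lborel_translation: "integrable lborel (\<lambda>y. g (y - x)) \<longleftrightarrow> integrable lborel g"
    and integral_lborel_translation: "integral\<^sup>L lborel (\<lambda>y. g (y - x)) = integral\<^sup>L lborel g"
  using integrable_distr_eq[of "(+) (- x)" lborel borel g] integral_distr[of "(+) (- x)" lborel borel g]
  by (simp_all add: lborel_distr_plus)

locale riesz_solution =
  fixes \<gamma> a p :: real and u :: "real ^ 'n::finite \<Rightarrow> real"
  assumes gamma_pos: "0 < \<gamma>" and gamma_less: "\<gamma> < real CARD('n)"
    and a_nonneg: "0 \<le> a" and p_pos: "0 < p"
    and u_cont: "continuous_on UNIV u" and u_nonneg: "\<And>x. 0 \<le> u x"
    and sol: "riesz_integral_solution \<gamma> a p u"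
begin

definition q :: real where "q = real CARD('n) - \<gamma>"

definition R :: real where "R = riesz_const \<gamma> CARD('n)"

text \<open>Here \<open>K x x = 0\<close> because of division by zero, so pointwise lower bounds on \<open>K x y\<close> exclude \<open>y = x\<close>.\<close>

definition K :: "real ^ 'n \<Rightarrow> real ^ 'n \<Rightarrow> real" where "K x y = R / norm (x - y) powr q"

definition f :: "real ^ 'n \<Rightarrow> real" where "f y = norm y powr a * u y powr p"

lemma q_pos: "q > 0"
  using gamma_less by (simp add: q_def)

lemma R_pos: "R > 0"
  unfolding R_def riesz_const_def using gamma_pos gamma_less
  by (intro divide_pos_pos mult_pos_pos Gamma_real_pos) auto

lemma isCont_u: "isCont u x"
  using u_cont continuous_on_eq_continuous_at[of UNIV u] by auto

lemma u_measurable [measurable]: "u \<in> borel_measurable borel"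
  using u_cont by (rule borel_measurable_continuous_onI)

lemma f_measurable [measurable]: "f \<in> borel_measurable borel"
  unfolding f_def by measurable

lemma K_measurable [measurable]: "K x \<in> borel_measurable borel"
  unfolding K_def by measurable

lemma f_nonneg: "0 \<le> f y"
  by (simp add: f_def)

lemma K_nonneg: "0 \<le> K x y"
  using R_pos by (simp add: K_def)

lemma K_ge: "x \<noteq> y \<Longrightarrow> norm (x - y) \<le> d \<Longrightarrow> R / d powr q \<le> K x y"
  unfolding K_def using R_pos q_pos
  by (intro divide_left_mono powr_mono2 mult_pos_pos) (auto intro: less_le_trans[of 0 "norm (x - y)"])

lemma K_le: "0 < d \<Longrightarrow> d \<le> norm (x - y) \<Longrightarrow> K x y \<le> R / d powr q"
  unfolding K_def using R_pos q_pos
  by (intro divide_left_mono powr_mono2 mult_pos_pos) auto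

lemma has_integral_u: "has_bochner_integral lborel (\<lambda>y. K x y * f y) (u x)"
  using sol unfolding riesz_integral_solution_def K_def f_def q_def R_def by blast

lemma integrable_Kf: "integrable lborel (\<lambda>y. K x y * f y)"
  and u_eq: "u x = integral\<^sup>L lborel (\<lambda>y. K x y * f y)"
  using has_integral_u[of x] by (auto simp: has_bochner_integral_iff)

section \<open>Lower bounds and positivity of nontrivial solutions\<close>

text \<open>Only the part of the integral over the ball is kept, where the kernel is at least
  \<open>R / d powr q\<close>. Both decay estimates below come from this bound.\<close>

lemma u_ge_ball:
  assumes "0 < r" "0 \<le> c" and ge: "\<And>y. y \<in> ball w r \<Longrightarrow> c \<le> f y"
    and dist: "\<And>y. y \<in> ball w r \<Longrightarrow> norm (x - y) \<le> d"
  shows "R / d powr q * c * (unit_ball_vol (real CARD('n)) * r ^ CARD('n)) \<le> u x"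
proof -
  have "R / d powr q * c * (unit_ball_vol (real CARD('n)) * r ^ CARD('n))
      = integral\<^sup>L lborel (\<lambda>y. R / d powr q * c * indicator (ball w r) y)"
    using content_ball[of r w] \<open>0 < r\<close> by simp
  also have "\<dots> \<le> integral\<^sup>L lborel (\<lambda>y. K x y * f y)"
  proof (rule integral_mono_AE)
    show "integrable lborel (\<lambda>y. R / d powr q * c * indicator (ball w r) y)"
      by (intro integrable_mult_right integrable_real_indicator) (use \<open>0 < r\<close> in \<open>auto simp: emeasure_ball\<close>)
    have "AE y in lborel. y \<noteq> x"
      by (rule AE_lborel_singleton)
    then show "AE y in lborel. R / d powr q * c * indicator (ball w r) y \<le> K x y * f y"
    proof eventually_elim
      case (elim y)
      show ?case
      proof (cases "y \<in> ball w r")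
        case True
        then have "R / d powr q * c \<le> K x y * f y"
          using elim K_ge[OF _ dist] ge \<open>0 \<le> c\<close> K_nonneg by (intro mult_mono) auto
        then show ?thesis using True by simp
      qed (simp add: K_nonneg f_nonneg)
    qed
  qed (rule integrable_Kf)
  finally show ?thesis by (simp add: u_eq)
qed

text \<open>By continuity u is positive near \<open>x\<^sub>1\<close>. The centre w is moved off the
  origin because the weight \<open>norm y powr a\<close> vanishes there, even for a = 0 under the
  convention \<open>0 powr 0 = 0\<close>.\<close>

lemma f_bounded_below_on_ball:
  assumes "u x\<^sub>1 \<noteq> 0"
  obtains r c w where "0 < r" "0 < c" "\<forall>y \<in> ball w r. c \<le> f y"
proof -
  have "0 < u x\<^sub>1" using assms u_nonneg[of x\<^sub>1] by simp
  then have "eventually (\<lambda>y. 0 < u y) (at x\<^sub>1)"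
    using isCont_u[of x\<^sub>1] by (auto simp: isCont_def order_tendsto_iff)
  moreover have "eventually (\<lambda>y. y \<noteq> 0) (at x\<^sub>1)"
    by (rule eventually_neq_at_within)
  ultimately have "eventually (\<lambda>y. 0 < u y \<and> y \<noteq> 0) (at x\<^sub>1)"
    by eventually_elim auto
  then obtain w where w: "0 < u w" "w \<noteq> 0"
    using eventually_happens'[OF at_neq_bot] by blast
  then have "isCont f w" "0 < f w"
    unfolding f_def by (auto intro!: continuous_intros isCont_u)
  then have "eventually (\<lambda>y. f w / 2 < f y) (nhds w)"
    by (intro order_tendstoD(1)[of _ "f w"]) (auto simp: isCont_def tendsto_nhds_iff)
  then obtain r where "0 < r" "\<And>y. dist y w < r \<Longrightarrow> f w / 2 < f y"
    unfolding eventually_nhds_metric by blast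
  then show ?thesis
    using that[of r "f w / 2" w] \<open>0 < f w\<close> by (auto simp: dist_commute less_imp_le)
qed

lemma u_lower_bound:
  assumes "u x\<^sub>1 \<noteq> 0"
  shows "\<exists>c>0. \<forall>x. c * (1 + norm x) powr (- q) \<le> u x"
proof -
  obtain r c w where w: "0 < r" "0 < c" "\<forall>y \<in> ball w r. c \<le> f y"
    using f_bounded_below_on_ball[OF assms] .
  \<comment> \<open>Chosen so that |x| + |w| + r is at most d (1 + |x|), which bounds |x - y| on the
    ball for every x at once.\<close>
  define d where "d = 1 + norm w + r"
  define C where "C = R / d powr q * c * (unit_ball_vol (real CARD('n)) * r ^ CARD('n))"
  have d: "d > 0" using w(1) by (simp add: d_def add_pos_nonneg)
  have "C * (1 + norm x) powr (- q) \<le> u x" for x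
  proof -
    have "norm (x - y) \<le> d * (1 + norm x)" if "y \<in> ball w r" for y
    proof -
      have "norm (x - y) \<le> norm x + norm w + norm (w - y)"
        using norm_triangle_ineq4[of x w] norm_triangle_ineq[of "x - w" "w - y"] by simp
      also have "\<dots> \<le> d * (1 + norm x)"
        using that[unfolded mem_ball dist_norm] mult_nonneg_nonneg[OF less_imp_le[OF w(1)] norm_ge_zero[of x]]
          mult_nonneg_nonneg[OF norm_ge_zero[of w] norm_ge_zero[of x]]
        unfolding d_def distrib_left distrib_right by linarith
      finally show ?thesis .
    qed
    from u_ge_ball[OF w(1) less_imp_le[OF w(2)] bspec[OF w(3)] this]
    have "R / (d * (1 + norm x)) powr q * c * (unit_ball_vol (real CARD('n)) * r ^ CARD('n)) \<le> u x" .
    then show ?thesis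
      using d by (simp add: C_def powr_mult powr_minus divide_simps)
  qed
  moreover have "C > 0"
    using w(1,2) R_pos d by (simp add: C_def)
  ultimately show ?thesis by blast
qed

lemma u_pos:
  assumes "u x\<^sub>1 \<noteq> 0"
  shows "0 < u x"
proof -
  obtain c where "c > 0" "c * (1 + norm x) powr (- q) \<le> u x"
    using u_lower_bound[OF assms] by blast
  moreover have "0 < 1 + norm x" by (simp add: add_pos_nonneg)
  ultimately show ?thesis by (smt (verit) mult_pos_pos powr_gt_zero)
qed

section \<open>Integrability of the kernel\<close>

lemma integrable_K_near_0:
  assumes "u x\<^sub>1 \<noteq> 0"
  obtains r where "0 < r" "integrable lborel (\<lambda>z. indicator (ball 0 r) z * K 0 z)"
proof -
  obtain r c w where w: "0 < r" "0 < c" "\<forall>y \<in> ball w r. c \<le> f y"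
    using f_bounded_below_on_ball[OF assms] .
  have m: "(\<lambda>z. indicator (ball 0 r) z * K 0 z) \<in> borel_measurable borel"
    by (intro borel_measurable_times borel_measurable_indicator) auto
  \<comment> \<open>Translated to w, the truncated kernel is dominated by 1/c times the integrand of
    \<open>u w\<close>, because f is at least c on the ball.\<close>
  have "integrable lborel (\<lambda>y. indicator (ball 0 r) (y - w) * K 0 (y - w))"
  proof (rule Bochner_Integration.integrable_bound)
    show "integrable lborel (\<lambda>y. 1 / c * (K w y * f y))"
      using integrable_Kf by simp
    show "AE y in lborel. norm (indicator (ball 0 r) (y - w) * K 0 (y - w)) \<le> norm (1 / c * (K w y * f y))"
    proof (rule AE_I2)
      fix y
      show "norm (indicator (ball 0 r) (y - w) * K 0 (y - w)) \<le> norm (1 / c * (K w y * f y))"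
      proof (cases "y \<in> ball w r")
        case True
        then have "K w y * 1 \<le> K w y * (f y / c)"
          using w K_nonneg by (intro mult_left_mono) auto
        moreover have "K 0 (y - w) = K w y" by (simp add: K_def)
        ultimately show ?thesis
          using w K_nonneg[of w y] f_nonneg[of y] by (simp add: indicator_def)
      qed (auto simp: dist_norm norm_minus_commute)
    qed
  qed (use measurable_compose[OF _ m, of "\<lambda>y. y - w"] in simp)
  then show ?thesis
    using that w(1) integrable_lborel_translation[OF m, of w] by blast
qed

text \<open>Uniform absolute continuity of the integral of the kernel. Its local integrability is not
  computed but read off from the finiteness of \<open>u\<close> at a point near which \<open>f\<close> is bounded below.\<close>

lemma K_integral_small:
  assumes "u x\<^sub>1 \<noteq> 0" "0 < \<epsilon>"
  shows "\<exists>\<delta>>0. \<forall>x E. E \<in> sets borel \<longrightarrow> emeasure lborel E < ennreal \<delta> \<longrightarrow>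
     set_integrable lborel E (K x) \<and> (LINT y:E|lborel. K x y) \<le> \<epsilon>"
proof -
  obtain r where r: "0 < r" and int: "integrable lborel (\<lambda>z. indicator (ball 0 r) z * K 0 z)"
    using integrable_K_near_0[OF assms(1)] .
  define g where "g s z = indicator (ball 0 s) z * K 0 z" for s and z :: "real ^ 'n"
  have g_meas [measurable]: "g s \<in> borel_measurable borel" for s
    unfolding g_def by (intro borel_measurable_times borel_measurable_indicator) auto
  have g_nonneg: "0 \<le> g s z" for s z
    using K_nonneg by (simp add: g_def)
  \<comment> \<open>Truncated to shrinking balls, the kernel tends to 0 at every point other than
    the origin; dominated convergence applies.\<close>
  have lim: "(\<lambda>k. integral\<^sup>L lborel (g (r / real (Suc k)))) \<longlonglongrightarrow> integral\<^sup>L lborel (\<lambda>z::real ^ 'n. 0)"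
  proof (rule integral_dominated_convergence[where w = "g r"])
    show "integrable lborel (g r)" using int by (simp add: g_def[abs_def])
    have "AE z in lborel. z \<noteq> (0 :: real ^ 'n)" by (rule AE_lborel_singleton)
    then show "AE z in lborel. (\<lambda>k. g (r / real (Suc k)) z) \<longlonglongrightarrow> 0"
    proof eventually_elim
      case (elim z)
      have "(\<lambda>k. r / real (Suc k)) \<longlonglongrightarrow> 0"
        by (rule LIMSEQ_Suc[OF lim_const_over_n])
      then have "eventually (\<lambda>k. r / real (Suc k) < norm z) sequentially"
        using elim by (intro order_tendstoD(2)) auto
      then have "eventually (\<lambda>k. g (r / real (Suc k)) z = 0) sequentially"
        by eventually_elim (auto simp: g_def)
      then show ?case by (rule tendsto_eventually)
    qed
    show "AE z in lborel. norm (g (r / real (Suc k)) z) \<le> g r z" for k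
    proof (rule AE_I2)
      fix z :: "real ^ 'n"
      have "r / real (Suc k) \<le> r" using r by (simp add: field_simps)
      then show "norm (g (r / real (Suc k)) z) \<le> g r z"
        using K_nonneg by (auto simp: g_def indicator_def)
    qed
  qed measurable
  then have "eventually (\<lambda>k. integral\<^sup>L lborel (g (r / real (Suc k))) < \<epsilon> / 2) sequentially"
    using assms(2) by (intro order_tendstoD(2)[OF lim]) auto
  then obtain k where k: "integral\<^sup>L lborel (g (r / real (Suc k))) < \<epsilon> / 2"
    by (auto simp: eventually_sequentially)
  define s where "s = r / real (Suc k)"
  have s: "0 < s" "s \<le> r" using r by (auto simp: s_def field_simps)
  have int_s: "integrable lborel (g s)"
    using s K_nonneg by (intro Bochner_Integration.integrable_bound[OF int]) (auto simp: g_def[abs_def] indicator_def intro!: AE_I2)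
  \<comment> \<open>Within distance s of x, translation reduces the kernel to \<open>g s\<close>,
    with integral below \<epsilon>/2 whatever x is. Farther away the kernel is at most A, whence the
    threshold \<epsilon>/(2A) for the measure of E.\<close>
  define A where "A = R / s powr q"
  have A: "A > 0" using R_pos s by (simp add: A_def)
  have "set_integrable lborel E (K x) \<and> (LINT y:E|lborel. K x y) \<le> \<epsilon>"
    if E [measurable]: "E \<in> sets borel" and mE: "emeasure lborel E < ennreal (\<epsilon> / (2 * A))" for x E
  proof -
    have intE: "integrable lborel (\<lambda>y. indicator E y :: real)"
      using mE E by (intro integrable_real_indicator) (auto simp: less_top[symmetric] intro: less_trans)
    have "measure lborel E < \<epsilon> / (2 * A)"
      using mE assms(2) A unfolding measure_def by (intro enn2real_less_iff[THEN iffD2]) (auto intro: less_trans)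
    then have mE': "A * measure lborel E < \<epsilon> / 2"
      using A by (simp add: field_simps)
    have int1: "integrable lborel (\<lambda>y. g s (y - x) + A * indicator E y)"
      using integrable_lborel_translation[of "g s" x] int_s intE by simp
    have le: "indicator E y *\<^sub>R K x y \<le> g s (y - x) + A * indicator E y" for y
    proof (cases "norm (x - y) < s")
      case True
      then have "g s (y - x) = K x y" by (simp add: g_def K_def norm_minus_commute)
      then show ?thesis using K_nonneg[of x y] A by (simp add: indicator_def)
    next
      case False
      then have "K x y \<le> A" unfolding A_def using K_le[OF s(1)] by simp
      then show ?thesis using g_nonneg[of s "y - x"] by (simp add: indicator_def)
    qed
    have int2: "integrable lborel (\<lambda>y. indicator E y *\<^sub>R K x y)"
    proof (rule Bochner_Integration.integrable_bound[OF int1])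
      show "AE y in lborel. norm (indicator E y *\<^sub>R K x y) \<le> norm (g s (y - x) + A * indicator E y)"
        using le K_nonneg by (intro AE_I2) (smt (verit) indicator_pos_le real_norm_def scaleR_nonneg_nonneg)
    qed measurable
    have "(LINT y:E|lborel. K x y) \<le> integral\<^sup>L lborel (\<lambda>y. g s (y - x) + A * indicator E y)"
      unfolding set_lebesgue_integral_def using int1 int2 le by (intro integral_mono) auto
    also have "\<dots> = integral\<^sup>L lborel (g s) + A * measure lborel E"
      using integral_lborel_translation[of "g s" x] integrable_lborel_translation[of "g s" x] int_s intE
      by simp
    also have "\<dots> \<le> \<epsilon>" using k mE' by (simp add: s_def)
    finally show ?thesis using int2 by (simp add: set_integrable_def)
  qed
  then show ?thesis
    using A assms(2) by (intro exI[of _ "\<epsilon> / (2 * A)"]) auto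
qed

subsection \<open>The Kelvin transform\<close>

text \<open>Splitting \<open>u\<close> and its Kelvin transform \<open>v l\<close> at the sphere of radius \<open>l\<close> and inverting the outer
  part gives, with \<open>x\<close> in \<open>D l\<close> and integrals over \<open>D l\<close>,
  \<open>u x = (LINT z. K x z * f z) + (LINT z. P l x z * h l z)\<close> and
  \<open>v l x = (LINT z. P l x z * f z) + (LINT z. K x z * h l z)\<close>.\<close>

definition v :: "real \<Rightarrow> real ^ 'n \<Rightarrow> real" where
  "v l x = (l / norm x) powr q * u (sphere_inv l x)"

definition P :: "real \<Rightarrow> real ^ 'n \<Rightarrow> real ^ 'n \<Rightarrow> real" where
  "P l x z = (l / norm x) powr q * K (sphere_inv l x) z"

definition h :: "real \<Rightarrow> real ^ 'n \<Rightarrow> real" where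
  "h l z = (l / norm z) powr (real CARD('n) + \<gamma>) * f (sphere_inv l z)"

definition D :: "real \<Rightarrow> (real ^ 'n) set" where "D l = ball 0 l - {0}"

lemma D_iff: "x \<in> D l \<longleftrightarrow> norm x < l \<and> x \<noteq> 0"
  by (simp add: D_def)

lemma D_borel [measurable, simp]: "D l \<in> sets borel"
  by (simp add: D_def)

text \<open>The Jacobian exponent is 2n = q + (n + \<gamma>): the factor with q is absorbed by the
  kernel, the other one goes into \<open>h\<close>.\<close>

lemma jacobian_split:
  assumes "0 < l" "z \<noteq> (0 :: real ^ 'n)"
  shows "(l / norm z) ^ (2 * CARD('n)) = (l / norm z) powr q * (l / norm z) powr (real CARD('n) + \<gamma>)"
proof -
  have "(l / norm z) ^ (2 * CARD('n)) = (l / norm z) powr (real (2 * CARD('n)))"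
    using assms by (subst powr_realpow) auto
  also have "real (2 * CARD('n)) = q + (real CARD('n) + \<gamma>)"
    by (simp add: q_def)
  finally show ?thesis by (simp only: powr_add)
qed

lemma K_sphere_inv_right:
  assumes "0 < l" "x \<noteq> 0" "z \<noteq> 0"
  shows "(l / norm z) powr q * K x (sphere_inv l z) = P l x z"
  unfolding K_def P_def
  using assms by (simp add: norm_diff_sphere_inv powr_mult powr_divide)

text \<open>Inverting both points multiplies their distance by l^2/(|x||z|), which the two weights
  cancel exactly.\<close>

lemma K_sphere_inv_both:
  assumes "0 < l" "x \<noteq> 0" "z \<noteq> 0"
  shows "(l / norm x) powr q * ((l / norm z) powr q * K (sphere_inv l x) (sphere_inv l z)) = K x z"
proof -
  have "l\<^sup>2 powr q = l powr q * l powr q"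
    using assms by (simp add: power2_eq_square powr_mult)
  then show ?thesis
    unfolding K_def using assms by (simp add: norm_sphere_inv_diff powr_mult powr_divide)
qed

text \<open>\<open>P l x z\<close> is the kernel at distance |x||x* - z|/l, with x* the inverse of
  x, and inside the sphere this exceeds |x - z|. The case z = x is excluded because
  \<open>K x x = 0\<close>.\<close>

lemma P_less_K:
  assumes "x \<in> D l" "z \<in> D l" "x \<noteq> z"
  shows "P l x z < K x z"
proof -
  have *: "l * norm (x - z) < norm x * norm (sphere_inv l x - z)" "0 < l"
    using assms norm_sphere_inv_diff_gt[of x l z] le_less_trans[OF norm_ge_zero, of x l] by (auto simp: D_iff)
  have "P l x z = R / (norm x * norm (sphere_inv l x - z) / l) powr q"
    using assms *(2) by (simp add: P_def K_def D_iff powr_mult powr_divide)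
  also have "\<dots> < K x z"
  proof -
    have "norm (x - z) < norm x * norm (sphere_inv l x - z) / l"
      using * by (simp add: field_simps)
    then show ?thesis
      unfolding K_def using R_pos q_pos assms(3)
      by (intro divide_strict_left_mono powr_less_mono2 mult_pos_pos)
         (auto intro: le_less_trans[OF norm_ge_zero])
  qed
  finally show ?thesis .
qed

lemma P_nonneg: "0 \<le> P l x z"
  using K_nonneg by (simp add: P_def)

section \<open>Splitting the integral at a sphere\<close>

text \<open>The sphere and the origin are null sets, and the exterior is pulled back to
  \<open>D l\<close> by the inversion.\<close>

lemma u_eq_D:
  assumes "0 < l"
  shows "set_integrable lborel (D l) (\<lambda>z. K w z * f z)" (is ?i1)
    and "set_integrable lborel (D l) (\<lambda>z. (l / norm z) ^ (2 * CARD('n)) * (K w (sphere_inv l z) * f (sphere_inv l z)))" (is ?i2)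
    and "u w = (LINT z:D l|lborel. K w z * f z)
      + (LINT z:D l|lborel. (l / norm z) ^ (2 * CARD('n)) * (K w (sphere_inv l z) * f (sphere_inv l z)))" (is ?e)
proof -
  let ?F = "\<lambda>z. K w z * f z"
  have si: "set_integrable lborel A ?F" if "A \<in> sets borel" for A
    unfolding set_integrable_def using that integrable_Kf by (intro integrable_mult_indicator) auto
  show ?i1 by (rule si) simp
  show ?i2 unfolding D_def by (rule set_integrable_sphere_inv[OF integrable_Kf assms])
  have "u w = integral\<^sup>L lborel ?F" by (rule u_eq)
  also have "\<dots> = integral\<^sup>L lborel (\<lambda>z. indicator (D l) z *\<^sub>R ?F z + indicator (- cball 0 l) z *\<^sub>R ?F z)"
  proof (rule integral_cong_AE)
    have "sphere (0 :: real ^ 'n) l \<in> null_sets lborel"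
      using negligible_sphere[of "0 :: real ^ 'n" l]
      by (simp only: negligible_iff_null_sets null_sets_completion_iff sets_lborel borel_closed closed_sphere)
    then have "AE z in lborel. z \<notin> sphere (0 :: real ^ 'n) l"
      by (rule AE_not_in)
    moreover have "AE z in lborel. z \<noteq> (0 :: real ^ 'n)"
      by (rule AE_lborel_singleton)
    ultimately show "AE z in lborel. ?F z = indicator (D l) z *\<^sub>R ?F z + indicator (- cball 0 l) z *\<^sub>R ?F z"
      by eventually_elim (auto simp: indicator_def D_iff)
  next
    show "(\<lambda>z. indicator (D l) z *\<^sub>R ?F z + indicator (- cball 0 l) z *\<^sub>R ?F z) \<in> borel_measurable lborel"
      by (intro borel_measurable_times borel_measurable_add borel_measurable_scaleR borel_measurable_indicator) simp_all
  qed simp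
  also have "\<dots> = (LINT z:D l|lborel. ?F z) + (LINT z:- cball 0 l|lborel. ?F z)"
    unfolding set_lebesgue_integral_def
    using si[of "D l"] si[of "- cball 0 l"]
    by (intro Bochner_Integration.integral_add) (auto simp: set_integrable_def)
  also have "(LINT z:- cball 0 l|lborel. ?F z)
      = (LINT z:D l|lborel. (l / norm z) ^ (2 * CARD('n)) * (K w (sphere_inv l z) * f (sphere_inv l z)))"
    unfolding D_def by (rule LINT_sphere_inv(2)[OF integrable_Kf assms, symmetric])
  finally show ?e .
qed

text \<open>Subtracting the two representations, the four integrands combine into one product. As
  \<open>P\<close> is below \<open>K\<close> off the diagonal, the sign of the integrand is that of
  \<open>h l z - f z\<close>.\<close>

lemma v_minus_u_eq:
  assumes x: "x \<in> D l"
  shows "set_integrable lborel (D l) (\<lambda>z. (K x z - P l x z) * (h l z - f z))"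
    and "v l x - u x = (LINT z:D l|lborel. (K x z - P l x z) * (h l z - f z))"
proof -
  have l: "0 < l" and x0: "x \<noteq> 0"
    using x le_less_trans[OF norm_ge_zero, of x l] by (auto simp: D_iff)
  let ?J = "\<lambda>z. (l / norm z) ^ (2 * CARD('n))" and ?t = "(l / norm x) powr q"
  have eqPh: "?J z * (K x (sphere_inv l z) * f (sphere_inv l z)) = P l x z * h l z" if "z \<in> D l" for z
    using K_sphere_inv_right[OF l x0, of z] jacobian_split[OF l, of z] that by (simp add: D_iff h_def)
  have eqPf: "?t * (K (sphere_inv l x) z * f z) = P l x z * f z" for z
    by (simp add: P_def)
  have eqKh: "?t * (?J z * (K (sphere_inv l x) (sphere_inv l z) * f (sphere_inv l z))) = K x z * h l z"
    if "z \<in> D l" for z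
    using K_sphere_inv_both[OF l x0, of z] jacobian_split[OF l, of z] that by (simp add: D_iff h_def)
  note ux = u_eq_D[OF l, of x] and uix = u_eq_D[OF l, of "sphere_inv l x"]
  have iPh: "set_integrable lborel (D l) (\<lambda>z. P l x z * h l z)"
    using ux(2) eqPh by (subst (asm) set_integrable_cong[OF refl refl]) auto
  have iPf: "set_integrable lborel (D l) (\<lambda>z. P l x z * f z)"
    using set_integrable_mult_right[of ?t, OF uix(1)] by (simp add: eqPf)
  have iKh: "set_integrable lborel (D l) (\<lambda>z. K x z * h l z)"
    using set_integrable_mult_right[of ?t, OF uix(2)] eqKh
    by (subst (asm) set_integrable_cong[OF refl refl]) auto
  have u1: "u x = (LINT z:D l|lborel. K x z * f z) + (LINT z:D l|lborel. P l x z * h l z)"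
  proof -
    have "(LINT z:D l|lborel. ?J z * (K x (sphere_inv l z) * f (sphere_inv l z))) = (LINT z:D l|lborel. P l x z * h l z)"
      by (rule set_lebesgue_integral_cong) (simp, intro allI impI eqPh)
    then show ?thesis using ux(3) by (simp only:)
  qed
  have "v l x = (LINT z:D l|lborel. ?t * (K (sphere_inv l x) z * f z))
     + (LINT z:D l|lborel. ?t * (?J z * (K (sphere_inv l x) (sphere_inv l z) * f (sphere_inv l z))))"
    unfolding v_def uix(3) by (simp only: set_integral_mult_right distrib_left)
  also have "\<dots> = (LINT z:D l|lborel. P l x z * f z) + (LINT z:D l|lborel. K x z * h l z)"
  proof -
    have "(LINT z:D l|lborel. ?t * (?J z * (K (sphere_inv l x) (sphere_inv l z) * f (sphere_inv l z))))
        = (LINT z:D l|lborel. K x z * h l z)"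
      by (rule set_lebesgue_integral_cong) (simp, intro allI impI eqKh)
    then show ?thesis by (simp only: eqPf)
  qed
  finally have v1: "v l x = (LINT z:D l|lborel. P l x z * f z) + (LINT z:D l|lborel. K x z * h l z)" .
  have e: "(\<lambda>z. (K x z - P l x z) * (h l z - f z))
      = (\<lambda>z. (K x z * h l z + P l x z * f z) - (K x z * f z + P l x z * h l z))"
    by (auto simp: algebra_simps)
  note s1 = set_integral_add[OF iKh iPf] and s2 = set_integral_add[OF ux(1) iPh]
  show "set_integrable lborel (D l) (\<lambda>z. (K x z - P l x z) * (h l z - f z))"
    unfolding e by (rule set_integral_diff(1)[OF s1(1) s2(1)])
  show "v l x - u x = (LINT z:D l|lborel. (K x z - P l x z) * (h l z - f z))"
    unfolding e set_integral_diff(2)[OF s1(1) s2(1)] s1(2) s2(2) u1 v1 by simp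
qed

text \<open>In the exponent, 2a comes from the weight at the inverted point and -pq from expressing
  u there through \<open>v l z\<close>.\<close>

lemma h_eq:
  assumes "0 < l" "z \<noteq> 0"
  shows "h l z = (l / norm z) powr (real CARD('n) + \<gamma> + 2 * a - p * q) * (norm z powr a * v l z powr p)"
proof -
  have "norm (sphere_inv l z) powr a = (l / norm z) powr (2 * a) * norm z powr a"
  proof -
    have "norm (sphere_inv l z) = (l / norm z) * (l / norm z) * norm z"
      using assms by (simp add: norm_sphere_inv power2_eq_square)
    also have "\<dots> powr a = (l / norm z) powr a * (l / norm z) powr a * norm z powr a"
      using assms by (simp only: powr_mult)
    finally show ?thesis by (simp add: powr_add[symmetric])
  qed
  moreover have "v l z powr p = (l / norm z) powr (p * q) * u (sphere_inv l z) powr p"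
    using u_nonneg by (simp add: v_def powr_mult powr_powr mult.commute)
  moreover have "(l / norm z) powr (real CARD('n) + \<gamma>) * (l / norm z) powr (2 * a)
      = (l / norm z) powr (real CARD('n) + \<gamma> + 2 * a - p * q) * (l / norm z) powr (p * q)"
    by (simp add: powr_add[symmetric])
  ultimately show ?thesis
    unfolding h_def f_def by (simp add: algebra_simps)
qed

end

subsection \<open>Moving spheres\<close>

text \<open>Mean value theorem; for p at least 1 the derivative is nondecreasing, so its value at b
  is an upper bound.\<close>

lemma powr_diff_le:
  fixes b c p :: real
  assumes "0 < c" "c \<le> b" "1 \<le> p"
  shows "b powr p - c powr p \<le> p * b powr (p - 1) * (b - c)"
proof (cases "c = b")
  case False
  have "((\<lambda>x. x powr p) has_real_derivative p * x powr (p - 1)) (at x)" if "c \<le> x" for x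
    using that assms by (intro has_real_derivative_powr) auto
  then obtain \<xi> where \<xi>: "c < \<xi>" "\<xi> < b" "b powr p - c powr p = (b - c) * (p * \<xi> powr (p - 1))"
    using MVT2[of c b "\<lambda>x. x powr p" "\<lambda>x. p * x powr (p - 1)"] assms False by auto
  have "(b - c) * (p * \<xi> powr (p - 1)) \<le> (b - c) * (p * b powr (p - 1))"
    using \<xi> assms by (intro mult_left_mono powr_mono2) auto
  then show ?thesis using \<xi>(3) by (simp add: mult_ac)
qed simp

context riesz_solution
begin

text \<open>The exponent left over in \<open>h_eq\<close>; it is positive exactly when p is
  subcritical.\<close>

definition \<tau> :: real where "\<tau> = real CARD('n) + \<gamma> + 2 * a - p * q"

definition dominates :: "real \<Rightarrow> bool" where "dominates l \<longleftrightarrow> (\<forall>x\<in>D l. u x \<le> v l x)"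

lemma D_pos: "x \<in> D l \<Longrightarrow> 0 < l"
  using le_less_trans[OF norm_ge_zero, of x l] by (simp add: D_iff)

lemma v_nonneg: "0 \<le> v l x"
  using u_nonneg by (simp add: v_def)

lemma v_pos:
  assumes "u x\<^sub>1 \<noteq> 0" "x \<in> D l"
  shows "0 < v l x"
  using u_pos[OF assms(1)] assms(2) D_pos[OF assms(2)] by (simp add: v_def D_iff)

lemma v_measurable [measurable]: "v l \<in> borel_measurable borel"
  unfolding v_def by measurable

lemma h_ge:
  assumes "0 \<le> \<tau>" "z \<in> D l"
  shows "norm z powr a * v l z powr p \<le> h l z"
proof -
  have "1 \<le> (l / norm z) powr \<tau>"
    using assms by (intro ge_one_powr_ge_zero) (auto simp: D_iff)
  then have "1 * (norm z powr a * v l z powr p) \<le> (l / norm z) powr \<tau> * (norm z powr a * v l z powr p)"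
    by (intro mult_right_mono) auto
  then show ?thesis
    using h_eq[of l z] assms D_pos by (simp add: D_iff \<tau>_def)
qed

text \<open>Domination gives f at most |z|^a \<open>v l z powr p\<close>, and this is strictly below
  \<open>h l z\<close> since l/|z| > 1 and \<tau> > 0. So the integrand of
  \<open>v_minus_u_eq\<close> is positive except at z = x.\<close>

lemma dominates_strict:
  assumes nz: "u x\<^sub>1 \<noteq> 0" and "0 < \<tau>" "dominates l" and x: "x \<in> D l"
  shows "u x < v l x"
proof -
  let ?G = "\<lambda>z. (K x z - P l x z) * (h l z - f z)"
  have pos: "0 < ?G z" if z: "z \<in> D l" "z \<noteq> x" for z
  proof -
    have "f z \<le> norm z powr a * v l z powr p"
      using \<open>dominates l\<close> z u_nonneg p_pos
      by (auto simp: f_def dominates_def intro!: mult_left_mono powr_mono2)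
    also have "\<dots> < h l z"
    proof -
      have "1 < (l / norm z) powr \<tau>"
        using z \<open>0 < \<tau>\<close> by (intro gr_one_powr) (auto simp: D_iff)
      moreover have "0 < norm z powr a * v l z powr p"
        using v_pos[OF nz z(1)] z by (simp add: D_iff)
      ultimately have "1 * (norm z powr a * v l z powr p) < (l / norm z) powr \<tau> * (norm z powr a * v l z powr p)"
        by (intro mult_strict_right_mono)
      then show ?thesis
        using h_eq[of l z] z D_pos by (simp add: D_iff \<tau>_def)
    qed
    finally show ?thesis
      using P_less_K[OF x z(1)] z(2) by (intro mult_pos_pos) auto
  qed
  have AEx: "AE z in lborel. z \<noteq> x" by (rule AE_lborel_singleton)
  have int: "integrable lborel (\<lambda>z. indicator (D l) z *\<^sub>R ?G z)"
    using v_minus_u_eq(1)[OF x] by (simp add: set_integrable_def)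
  have nonneg: "AE z in lborel. 0 \<le> indicator (D l) z *\<^sub>R ?G z"
    using AEx
  proof eventually_elim
    case (elim z)
    then show ?case using pos[of z] by (cases "z \<in> D l") auto
  qed
  have eq: "v l x - u x = integral\<^sup>L lborel (\<lambda>z. indicator (D l) z *\<^sub>R ?G z)"
    using v_minus_u_eq(2)[OF x] by (simp add: set_lebesgue_integral_def)
  \<comment> \<open>A vanishing integral would make the positive integrand vanish almost everywhere,
    turning the ball into a null set.\<close>
  have "integral\<^sup>L lborel (\<lambda>z. indicator (D l) z *\<^sub>R ?G z) \<noteq> 0"
  proof
    assume "integral\<^sup>L lborel (\<lambda>z. indicator (D l) z *\<^sub>R ?G z) = 0"
    then have "AE z in lborel. indicator (D l) z *\<^sub>R ?G z = 0"
      using integral_nonneg_eq_0_iff_AE[OF int nonneg] by simp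
    moreover have "AE z in lborel. z \<noteq> (0 :: real ^ 'n)" by (rule AE_lborel_singleton)
    ultimately have "AE z in lborel. z \<notin> ball (0 :: real ^ 'n) l"
      using AEx
    proof eventually_elim
      case (elim z)
      then show ?case using pos[of z] by (cases "z \<in> D l") (auto simp: D_iff)
    qed
    then have "emeasure lborel (ball (0 :: real ^ 'n) l) = 0"
      by (subst (asm) AE_iff_measurable[OF _ refl]) (auto simp: ball_def)
    then show False
      using D_pos[OF x] unit_ball_vol_pos[of "real CARD('n)"] by (simp add: emeasure_ball)
  qed
  moreover have "0 \<le> integral\<^sup>L lborel (\<lambda>z. indicator (D l) z *\<^sub>R ?G z)"
    using nonneg by (rule integral_nonneg_AE)
  ultimately show ?thesis using eq by simp
qed

text \<open>The positive part \<open>w\<close> of \<open>u - v l\<close> satisfies \<open>sup w \<le> C * (sup w) * (LINT y:E. K x y)\<close>, where \<open>E\<close> is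
  the set on which \<open>w > 0\<close>; when \<open>E\<close> is small this forces \<open>w = 0\<close>.\<close>

lemma dominates_if_small_measure:
  assumes nz: "u x\<^sub>1 \<noteq> 0" and "0 \<le> \<tau>" "1 \<le> p" "0 < L"
  shows "\<exists>\<delta>>0. \<forall>l. 0 < l \<longrightarrow> l \<le> L \<longrightarrow> emeasure lborel {x \<in> D l. v l x < u x} < ennreal \<delta> \<longrightarrow> dominates l"
proof -
  have "bounded (u ` cball 0 L)"
    by (intro compact_imp_bounded compact_continuous_image continuous_on_subset[OF u_cont]) auto
  then obtain U where U: "0 < U" "\<forall>y \<in> u ` cball 0 L. norm y \<le> U"
    unfolding bounded_pos by (elim exE conjE)
  have U_ge: "u x \<le> U" if "norm x \<le> L" for x
    using bspec[OF U(2), of "u x"] that by simp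
  \<comment> \<open>A bound for the weight on the ball of radius L times a Lipschitz constant of the
    p-th power on [0, U]. With kernel mass at most 1/(2C) over E, the estimate gains a factor
    1/2.\<close>
  define C where "C = L powr a * (p * U powr (p - 1))"
  have C: "0 < C" using \<open>0 < L\<close> U(1) p_pos by (simp add: C_def)
  then have "0 < 1 / (2 * C)" by simp
  from K_integral_small[OF nz this]
  obtain \<delta> where \<delta>: "0 < \<delta>" "\<forall>x E. E \<in> sets borel \<longrightarrow> emeasure lborel E < ennreal \<delta> \<longrightarrow>
     set_integrable lborel E (K x) \<and> (LINT y:E|lborel. K x y) \<le> 1 / (2 * C)"
    by (elim exE conjE)
  have "dominates l"
    if l: "0 < l" "l \<le> L" and small: "emeasure lborel {x \<in> D l. v l x < u x} < ennreal \<delta>" for l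
  proof (rule ccontr)
    assume "\<not> dominates l"
    define E where "E = {x \<in> D l. v l x < u x}"
    have "E = D l \<inter> {x. v l x < u x}" by (auto simp: E_def)
    then have E_borel: "E \<in> sets borel" by simp
    have E: "x \<in> D l" "v l x < u x" "u x \<le> U" if "x \<in> E" for x
      using that l U_ge[of x] by (auto simp: E_def D_iff)
    obtain x\<^sub>0 where x0: "x\<^sub>0 \<in> E"
      using \<open>\<not> dominates l\<close> by (auto simp: E_def dominates_def not_le)
    define M where "M = (SUP x\<in>E. u x - v l x)"
    have "u x - v l x \<le> U" if "x \<in> E" for x
      using E(3)[OF that] v_nonneg[of l x] by simp
    then have bdd: "bdd_above ((\<lambda>x. u x - v l x) ` E)" by (intro bdd_aboveI2)
    have M_ge: "u x - v l x \<le> M" if "x \<in> E" for x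
      unfolding M_def by (rule cSUP_upper[OF that bdd])
    have M_pos: "0 < M" using M_ge[OF x0] E(2)[OF x0] by simp
    have "u x - v l x \<le> M / 2" if "x \<in> E" for x
    proof -
      have x: "x \<in> D l" by (rule E(1)[OF that])
      have K_int: "set_integrable lborel E (K x)" "(LINT y:E|lborel. K x y) \<le> 1 / (2 * C)"
        using \<delta>(2)[rule_format, OF E_borel, of x] small unfolding E_def by blast+
      let ?G = "\<lambda>z. (K x z - P l x z) * (h l z - f z)"
      have f_minus_h: "f z - h l z \<le> C * M" if z: "z \<in> E" for z
      proof -
        have "f z - h l z \<le> norm z powr a * (u z powr p - v l z powr p)"
          using h_ge[OF \<open>0 \<le> \<tau>\<close> E(1)[OF z]] by (simp add: f_def algebra_simps)
        also have "\<dots> \<le> norm z powr a * (p * u z powr (p - 1) * (u z - v l z))"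
          using E(2)[OF z] v_pos[OF nz E(1)[OF z]] \<open>1 \<le> p\<close> by (intro mult_left_mono powr_diff_le) auto
        also have "\<dots> \<le> L powr a * (p * U powr (p - 1) * M)"
        proof (intro mult_mono)
          show "norm z powr a \<le> L powr a"
            using E(1)[OF z] l a_nonneg by (intro powr_mono2) (auto simp: D_iff)
          show "u z powr (p - 1) \<le> U powr (p - 1)"
            using E(3)[OF z] u_nonneg \<open>1 \<le> p\<close> by (intro powr_mono2) auto
        qed (use p_pos M_pos M_ge[OF z] E(2)[OF z] in auto)
        finally show ?thesis by (simp add: C_def mult_ac)
      qed
      have "u x - v l x = integral\<^sup>L lborel (\<lambda>z. - (indicator (D l) z *\<^sub>R ?G z))"
        using v_minus_u_eq(2)[OF x] by (simp add: set_lebesgue_integral_def)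
      \<comment> \<open>Outside E, u is at most \<open>v l\<close>, so the integrand is nonpositive
        and is dropped. On E the factor \<open>K x z - P l x z\<close> is enlarged to
        \<open>K x z\<close>.\<close>
      also have "\<dots> \<le> integral\<^sup>L lborel (\<lambda>z. C * M * (indicator E z *\<^sub>R K x z))"
      proof (rule integral_mono_AE)
        show "integrable lborel (\<lambda>z. - (indicator (D l) z *\<^sub>R ?G z))"
          using v_minus_u_eq(1)[OF x] by (simp add: set_integrable_def)
        show "integrable lborel (\<lambda>z. C * M * (indicator E z *\<^sub>R K x z))"
          using K_int(1) unfolding set_integrable_def by (rule integrable_mult_right)
        have "AE z in lborel. z \<noteq> x" by (rule AE_lborel_singleton)
        then show "AE z in lborel. - (indicator (D l) z *\<^sub>R ?G z) \<le> C * M * (indicator E z *\<^sub>R K x z)"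
        proof eventually_elim
          case (elim z)
          show ?case
          proof (cases "z \<in> D l")
            case True
            have K: "0 \<le> K x z - P l x z" "K x z - P l x z \<le> K x z"
              using P_less_K[OF x True] elim P_nonneg[of l x z] by auto
            show ?thesis
            proof (cases "z \<in> E")
              case z: True
              have "(K x z - P l x z) * (f z - h l z) \<le> (K x z - P l x z) * (C * M)"
                using f_minus_h[OF z] K(1) by (rule mult_left_mono)
              also have "\<dots> \<le> K x z * (C * M)"
                using K(2) C M_pos by (intro mult_right_mono) auto
              finally show ?thesis using True z by (simp add: algebra_simps)
            next
              case z: False
              then have "u z \<le> v l z" using True by (auto simp: E_def)
              then have "f z \<le> norm z powr a * v l z powr p"
                using u_nonneg p_pos by (auto simp: f_def intro!: mult_left_mono powr_mono2)
              also have "\<dots> \<le> h l z" by (rule h_ge[OF \<open>0 \<le> \<tau>\<close> True])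
              finally show ?thesis using z True K(1) by simp
            qed
          next
            case False
            then have "z \<notin> E" using E(1) by blast
            with False show ?thesis by simp
          qed
        qed
      qed
      also have "\<dots> = C * M * (LINT y:E|lborel. K x y)"
        by (simp add: set_lebesgue_integral_def)
      also have "\<dots> \<le> C * M * (1 / (2 * C))"
        using K_int(2) C M_pos by (intro mult_left_mono) auto
      also have "\<dots> = M / 2" using C by simp
      finally show ?thesis .
    qed
    then have "M \<le> M / 2"
      unfolding M_def using x0 by (intro cSUP_least) auto
    then show False using M_pos by simp
  qed
  then show ?thesis using \<delta>(1) by blast
qed

lemma tendsto_v:
  assumes "0 < l" "x \<noteq> 0" "(ls \<longlongrightarrow> l) F"
  shows "((\<lambda>k. v (ls k) x) \<longlongrightarrow> v l x) F"
proof -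
  have "((\<lambda>k. sphere_inv (ls k) x) \<longlongrightarrow> sphere_inv l x) F"
    unfolding sphere_inv_def using assms by (intro tendsto_intros) auto
  then have "((\<lambda>k. u (sphere_inv (ls k) x)) \<longlongrightarrow> u (sphere_inv l x)) F"
    by (rule isCont_tendsto_compose[OF isCont_u])
  then show ?thesis
    unfolding v_def using assms by (intro tendsto_intros) auto
qed

text \<open>The case l = 0 starts the spheres and l > 0 continues them. Inside radius l strict
  domination survives small changes of the radius; a point outside eventually leaves
  \<open>D (ls k)\<close>. Hence the bad sets shrink to a null set.\<close>

lemma eventually_dominates:
  assumes nz: "u x\<^sub>1 \<noteq> 0" and "0 < \<tau>" "1 \<le> p" and l: "0 \<le> l" "0 < l \<Longrightarrow> dominates l"
    and ls: "ls \<longlonglongrightarrow> l" "\<And>k. 0 < ls k"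
  shows "eventually (\<lambda>k. dominates (ls k)) sequentially"
proof -
  \<comment> \<open>A common bound for the radii near l, so that one \<delta> serves all of
    them.\<close>
  define L where "L = l + 1"
  have "0 < L" using l by (simp add: L_def)
  obtain \<delta> where \<delta>: "0 < \<delta>"
    "\<forall>l. 0 < l \<longrightarrow> l \<le> L \<longrightarrow> emeasure lborel {x \<in> D l. v l x < u x} < ennreal \<delta> \<longrightarrow> dominates l"
    using dominates_if_small_measure[OF nz less_imp_le[OF \<open>0 < \<tau>\<close>] \<open>1 \<le> p\<close> \<open>0 < L\<close>] by (elim exE conjE)
  \<comment> \<open>Cutting with \<open>cball 0 L\<close> provides an integrable majorant and
    changes nothing once \<open>ls k < L\<close>.\<close>
  define E where "E k = D (ls k) \<inter> {x. v (ls k) x < u x} \<inter> cball 0 L" for k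
  have E_borel [measurable]: "E k \<in> sets borel" for k
    unfolding E_def by (intro sets.Int) auto
  have E_fin: "emeasure lborel (E k) < \<infinity>" for k
  proof -
    have "emeasure lborel (E k) \<le> emeasure lborel (cball (0 :: real ^ 'n) L)"
      by (rule emeasure_mono) (auto simp: E_def)
    also have "\<dots> < \<infinity>" using \<open>0 < L\<close> by (simp add: emeasure_cball)
    finally show ?thesis .
  qed
  have "(\<lambda>k. integral\<^sup>L lborel (indicator (E k) :: _ \<Rightarrow> real)) \<longlonglongrightarrow> integral\<^sup>L lborel (\<lambda>x::real ^ 'n. 0)"
  proof (rule integral_dominated_convergence[where w = "indicator (cball 0 L)"])
    show "integrable lborel (indicator (cball (0 :: real ^ 'n) L) :: _ \<Rightarrow> real)"
      using \<open>0 < L\<close> by (intro integrable_real_indicator) (auto simp: emeasure_cball)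
    show "AE x in lborel. norm (indicator (E k) x :: real) \<le> indicator (cball 0 L) x" for k
      by (rule AE_I2) (auto simp: E_def indicator_def)
    have "sphere (0 :: real ^ 'n) l \<in> null_sets lborel"
      using negligible_sphere[of "0 :: real ^ 'n" l]
      by (simp only: negligible_iff_null_sets null_sets_completion_iff sets_lborel borel_closed closed_sphere)
    then have "AE x in lborel. x \<notin> sphere (0 :: real ^ 'n) l"
      by (rule AE_not_in)
    moreover have "AE x in lborel. x \<noteq> (0 :: real ^ 'n)"
      by (rule AE_lborel_singleton)
    ultimately show "AE x in lborel. (\<lambda>k. indicator (E k) x :: real) \<longlonglongrightarrow> 0"
    proof eventually_elim
      case (elim x)
      have "eventually (\<lambda>k. x \<notin> E k) sequentially"
      proof (cases "norm x < l")
        case True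
        then have "x \<in> D l" "0 < l" using elim le_less_trans[OF norm_ge_zero, of x l] by (auto simp: D_iff)
        then have "u x < v l x" using dominates_strict[OF nz \<open>0 < \<tau>\<close> l(2)] by blast
        then have "eventually (\<lambda>k. u x < v (ls k) x) sequentially"
          using tendsto_v[OF \<open>0 < l\<close> _ ls(1), of x] elim by (intro order_tendstoD(1)) auto
        then show ?thesis by eventually_elim (auto simp: E_def)
      next
        case False
        then have "l < norm x" using elim by auto
        then have "eventually (\<lambda>k. ls k < norm x) sequentially"
          using ls(1) by (intro order_tendstoD(2))
        then show ?thesis by eventually_elim (auto simp: E_def D_iff)
      qed
      then have "eventually (\<lambda>k. indicator (E k) x = (0 :: real)) sequentially"
        by eventually_elim simp
      then show ?case by (rule tendsto_eventually)
    qed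
  qed simp_all
  then have "(\<lambda>k. measure lborel (E k)) \<longlonglongrightarrow> 0" by simp
  then have "eventually (\<lambda>k. measure lborel (E k) < \<delta>) sequentially"
    using \<delta>(1) by (intro order_tendstoD(2)[where a = \<delta>])
  moreover have "eventually (\<lambda>k. ls k < L) sequentially"
    using ls(1) by (intro order_tendstoD(2)) (auto simp: L_def)
  ultimately show ?thesis
  proof eventually_elim
    case (elim k)
    have "{x \<in> D (ls k). v (ls k) x < u x} = E k"
      using elim by (auto simp: E_def D_iff)
    moreover have "emeasure lborel (E k) < ennreal \<delta>"
    proof -
      have "emeasure lborel (E k) = ennreal (measure lborel (E k))"
        using E_fin[of k] by (intro emeasure_eq_ennreal_measure) auto
      then show ?thesis using elim \<delta>(1) by (simp only: ennreal_lessI)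
    qed
    ultimately show ?case using \<delta>(2)[rule_format, of "ls k"] ls(2) elim by simp
  qed
qed

text \<open>A connectedness argument on the half-line: the good radii form a nonempty set that is
  both open and closed.\<close>

lemma dominates_all:
  assumes nz: "u x\<^sub>1 \<noteq> 0" and "0 < \<tau>" "1 \<le> p" and "0 < l"
  shows "dominates l"
proof -
  \<comment> \<open>Radius 0 counts as good by convention, so openness at 0 already yields all small
    radii.\<close>
  define A where "A = {l. 0 \<le> l \<and> (0 < l \<longrightarrow> dominates l)}"
  have "openin (top_of_set {0..}) A"
    unfolding openin_euclidean_subtopology_iff
  proof (intro conjI ballI)
    fix l assume l: "l \<in> A"
    show "\<exists>e>0. \<forall>l'\<in>{0..}. dist l' l < e \<longrightarrow> l' \<in> A"
    proof (rule ccontr)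
      assume "\<not> ?thesis"
      \<comment> \<open>If A were not open at l, there would be bad positive radii converging to l,
        against \<open>eventually_dominates\<close>.\<close>
      then have "\<forall>k. \<exists>l'. 0 \<le> l' \<and> dist l' l < inverse (real (Suc k)) \<and> l' \<notin> A"
        by (metis atLeast_iff inverse_positive_iff_positive of_nat_0_less_iff zero_less_Suc)
      then obtain ls where ls: "\<And>k. 0 \<le> ls k \<and> dist (ls k) l < inverse (real (Suc k)) \<and> ls k \<notin> A"
        by metis
      have "(\<lambda>k. dist (ls k) l) \<longlonglongrightarrow> 0"
      proof (rule tendsto_sandwich[OF _ _ tendsto_const LIMSEQ_inverse_real_of_nat])
        show "eventually (\<lambda>k. dist (ls k) l \<le> inverse (real (Suc k))) sequentially"
          using ls by (intro always_eventually allI less_imp_le) blast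
      qed simp
      then have "ls \<longlonglongrightarrow> l" by (rule iffD2[OF tendsto_dist_iff])
      moreover have "0 < ls k \<and> \<not> dominates (ls k)" for k
        using ls[of k] by (auto simp: A_def)
      ultimately show False
        using eventually_dominates[OF nz \<open>0 < \<tau>\<close> \<open>1 \<le> p\<close>, of l ls] l
        by (simp add: A_def eventually_sequentially)
    qed
  qed (auto simp: A_def)
  moreover have "closed A"
    unfolding closed_sequential_limits
  proof (intro allI impI, elim conjE)
    fix ls l assume ls: "\<forall>k. ls k \<in> A" "ls \<longlonglongrightarrow> l"
    have "0 \<le> l"
      using ls by (intro LIMSEQ_le_const[OF ls(2)]) (auto simp: A_def)
    moreover have "dominates l" if "0 < l"
      unfolding dominates_def
    proof
      fix x assume x: "x \<in> D l"
      then have "eventually (\<lambda>k. norm x < ls k) sequentially"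
        using ls(2) by (intro order_tendstoD(1)) (auto simp: D_iff)
      then have "eventually (\<lambda>k. u x \<le> v (ls k) x) sequentially"
      proof eventually_elim
        case (elim k)
        then have "x \<in> D (ls k)" using x by (simp add: D_iff)
        then show ?case using ls(1) D_pos by (auto simp: A_def dominates_def)
      qed
      then show "u x \<le> v l x"
        using x by (intro tendsto_lowerbound[OF tendsto_v[OF that _ ls(2)]]) (auto simp: D_iff)
    qed
    ultimately show "l \<in> A" by (auto simp: A_def)
  qed
  then have "closedin (top_of_set {0..}) A"
    by (rule closed_subset[rotated]) (auto simp: A_def)
  moreover have "0 \<in> A" by (simp add: A_def)
  ultimately have "A = {0..}"
    using connected_clopen[of "{0::real..}"] connected_Ici by blast
  with \<open>0 < l\<close> have "l \<in> A" by simp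
  then show ?thesis using \<open>0 < l\<close> by (simp add: A_def)
qed

text \<open>For each z a radius is chosen whose inversion sends z to a point x with |x| = 1/2. There
  u has a fixed positive lower bound, and domination transfers it to z with the factor
  (2|z|)^(-q/2).\<close>

lemma u_lower_bound_moving_spheres:
  assumes nz: "u x\<^sub>1 \<noteq> 0" and "0 < \<tau>" "1 \<le> p"
  shows "\<exists>c>0. \<forall>z. 1 \<le> norm z \<longrightarrow> c * norm z powr - (q / 2) \<le> u z"
proof -
  obtain c where c: "0 < c" "\<And>x. c * (1 + norm x) powr (- q) \<le> u x"
    using u_lower_bound[OF nz] by blast
  define C where "C = c * (3 / 2) powr (- q) * 2 powr - (q / 2)"
  have "C * norm z powr - (q / 2) \<le> u z" if z: "1 \<le> norm z" for z
  proof -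
    \<comment> \<open>Solves l^2/|z| = 1/2; since |z| is at least 1, also l > 1/2, which puts x
      inside the sphere.\<close>
    define l where "l = sqrt (norm z / 2)"
    have norm_z: "0 < norm z" using z by linarith
    then have l: "0 < l" "l\<^sup>2 = norm z / 2"
      by (simp_all add: l_def)
    have z0: "z \<noteq> 0" using norm_z by simp
    define x where "x = sphere_inv l z"
    have norm_x: "norm x = 1 / 2" using z0 l by (simp add: x_def norm_sphere_inv)
    have "(1 / 2)\<^sup>2 < l\<^sup>2" unfolding l(2) using z by (simp add: power2_eq_square)
    then have "1 / 2 < l" by (rule power2_less_imp_less) (rule less_imp_le[OF l(1)])
    moreover have "x \<noteq> 0" using norm_x by auto
    ultimately have "x \<in> D l" by (simp add: D_iff norm_x)
    then have "u x \<le> v l x" using dominates_all[OF assms l(1)] by (simp add: dominates_def)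
    also have "\<dots> = (2 * l) powr q * u z"
    proof -
      have "sphere_inv l x = z" using l(1) z0 by (simp add: x_def sphere_inv_involution)
      then show ?thesis unfolding v_def norm_x by (simp add: mult.commute)
    qed
    also have "(2 * l) powr q = ((2 * l)\<^sup>2) powr (q / 2)"
    proof -
      have "(2 * l)\<^sup>2 = (2 * l) powr 2" using l(1) by (simp only: powr_numeral)
      then show ?thesis by (simp add: powr_powr)
    qed
    also have "(2 * l)\<^sup>2 = 2 * norm z" unfolding power_mult_distrib l(2) by simp
    finally have le: "c * (3 / 2) powr (- q) \<le> (2 * norm z) powr (q / 2) * u z"
      using c(2)[of x] norm_x by simp
    have "C * norm z powr - (q / 2) = c * (3 / 2) powr (- q) * (2 * norm z) powr - (q / 2)"
      by (simp add: C_def powr_mult)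
    also have "\<dots> \<le> (2 * norm z) powr (q / 2) * u z * (2 * norm z) powr - (q / 2)"
      using le by (rule mult_right_mono) simp
    also have "\<dots> = u z"
      using norm_z by (simp add: powr_minus)
    finally show ?thesis .
  qed
  moreover have "0 < C" using c by (simp add: C_def)
  ultimately show ?thesis by blast
qed

subsection \<open>Improving the decay\<close>

text \<open>Only a ball of radius comparable to |x| is used. Kernel, weight, power of u and volume
  contribute -q + a - p\<mu> + n = -(p\<mu> - a - \<gamma>). Letting x' differ from x allows x' = 0
  with |x| arbitrarily large.\<close>

lemma decay_improvement:
  assumes c: "0 < c" and \<mu>: "0 \<le> \<mu>" and lower: "\<And>x. 1 \<le> norm x \<Longrightarrow> c * norm x powr - \<mu> \<le> u x"
  shows "\<exists>c'>0. \<forall>(x :: real ^ 'n) x'. 1 \<le> norm x \<longrightarrow> norm x' \<le> norm x \<longrightarrow> c' * norm x powr - (p * \<mu> - a - \<gamma>) \<le> u x'"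
proof -
  define C where "C = R * 3 powr - q * (c * 2 powr - \<mu>) powr p * (unit_ball_vol (real CARD('n)) * (1 / 2) ^ CARD('n))"
  have "0 < C" using c R_pos unit_ball_vol_pos[of "real CARD('n)"] by (simp add: C_def)
  moreover have "C * norm x powr - (p * \<mu> - a - \<gamma>) \<le> u x'" if x: "1 \<le> norm x" "norm x' \<le> norm x" for x x' :: "real ^ 'n"
  proof -
    \<comment> \<open>Centre 3x/2 and radius |x|/2 keep the ball in the shell from |x| to 2|x|,
      where the assumed lower bound holds.\<close>
    let ?r = "norm x" let ?w = "(3 / 2) *\<^sub>R x"
    have r: "0 < ?r" using x by linarith
    have y: "?r \<le> norm y \<and> norm y \<le> 2 * ?r" if "y \<in> ball ?w (?r / 2)" for y
    proof -
      have "norm (?w - y) < ?r / 2" using that by (simp add: dist_norm)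
      moreover have "norm ?w = 3 / 2 * ?r" by simp
      ultimately show ?thesis
        using norm_triangle_ineq3[of ?w y] by linarith
    qed
    have f_ge: "?r powr a * (c * (2 * ?r) powr - \<mu>) powr p \<le> f y" if "y \<in> ball ?w (?r / 2)" for y
      unfolding f_def
    proof (intro mult_mono powr_mono2)
      have "c * (2 * ?r) powr - \<mu> \<le> c * norm y powr - \<mu>"
        using y[OF that] c \<mu> r by (intro mult_left_mono powr_mono2') auto
      also have "\<dots> \<le> u y" using y[OF that] x by (intro lower) auto
      finally show "c * (2 * ?r) powr - \<mu> \<le> u y" .
    qed (use y[OF that] a_nonneg p_pos c in auto)
    have dist: "norm (x' - y) \<le> 3 * ?r" if "y \<in> ball ?w (?r / 2)" for y
      using norm_triangle_ineq4[of x' y] y[OF that] x by linarith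
    have "R / (3 * ?r) powr q * (?r powr a * (c * (2 * ?r) powr - \<mu>) powr p)
        * (unit_ball_vol (real CARD('n)) * (?r / 2) ^ CARD('n)) \<le> u x'"
      by (rule u_ge_ball[OF _ _ f_ge dist]) (use r in auto)
    also have "R / (3 * ?r) powr q * (?r powr a * (c * (2 * ?r) powr - \<mu>) powr p)
        * (unit_ball_vol (real CARD('n)) * (?r / 2) ^ CARD('n))
      = C * (?r powr - q * ?r powr a * ?r powr (- \<mu> * p) * ?r powr real CARD('n))"
    proof -
      have "(c * (2 * ?r) powr - \<mu>) powr p = (c * 2 powr - \<mu>) powr p * ?r powr (- \<mu> * p)"
        using c by (simp add: powr_mult powr_powr)
      moreover have "R / (3 * ?r) powr q = R * 3 powr - q * ?r powr - q"
        by (simp add: powr_mult powr_minus divide_inverse)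
      moreover have "(?r / 2) ^ CARD('n) = (1 / 2) ^ CARD('n) * ?r powr real CARD('n)"
        using r by (simp add: powr_realpow power_divide)
      ultimately show ?thesis by (simp add: C_def)
    qed
    also have "?r powr - q * ?r powr a * ?r powr (- \<mu> * p) * ?r powr real CARD('n) = ?r powr - (p * \<mu> - a - \<gamma>)"
      by (simp add: powr_add[symmetric] q_def algebra_simps)
    finally show ?thesis .
  qed
  ultimately show ?thesis by blast
qed

text \<open>Each application of \<open>decay_improvement\<close> lowers the exponent by at least d,
  yet it must stay nonnegative: a negative exponent would give arbitrarily large lower bounds for
  \<open>u 0\<close>.\<close>

lemma no_slow_decay:
  assumes "0 < c" "0 \<le> \<mu>\<^sub>0" and lower: "\<And>x. 1 \<le> norm x \<Longrightarrow> c * norm x powr - \<mu>\<^sub>0 \<le> u x"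
    and d: "0 < d" "\<And>\<mu>. 0 \<le> \<mu> \<Longrightarrow> \<mu> \<le> \<mu>\<^sub>0 \<Longrightarrow> p * \<mu> - a - \<gamma> \<le> \<mu> - d"
  shows False
proof -
  have "\<exists>c \<mu>. 0 < c \<and> 0 \<le> \<mu> \<and> \<mu> \<le> \<mu>\<^sub>0 - real k * d \<and> (\<forall>x. 1 \<le> norm x \<longrightarrow> c * norm x powr - \<mu> \<le> u x)" for k
  proof (induction k)
    case 0
    show ?case using assms(1-3) by (intro exI[of _ c] exI[of _ \<mu>\<^sub>0]) auto
  next
    case (Suc k)
    then obtain c \<mu> where c: "0 < c" and \<mu>: "0 \<le> \<mu>" "\<mu> \<le> \<mu>\<^sub>0 - real k * d"
      and lower: "\<forall>x. 1 \<le> norm x \<longrightarrow> c * norm x powr - \<mu> \<le> u x"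
      by (elim exE conjE)
    define \<mu>' where "\<mu>' = p * \<mu> - a - \<gamma>"
    obtain c' where c': "0 < c'" "\<forall>(x :: real ^ 'n) x'. 1 \<le> norm x \<longrightarrow> norm x' \<le> norm x \<longrightarrow> c' * norm x powr - \<mu>' \<le> u x'"
      using decay_improvement[OF c \<mu>(1)] lower unfolding \<mu>'_def by blast
    have "0 \<le> real k * d" using d(1) by simp
    then have "\<mu>' \<le> \<mu> - d" unfolding \<mu>'_def using d(2) \<mu> by simp
    then have "\<mu>' \<le> \<mu>\<^sub>0 - real (Suc k) * d" using \<mu>(2) by (simp add: algebra_simps)
    moreover have "0 \<le> \<mu>'"
    proof (rule ccontr)
      assume neg: "\<not> 0 \<le> \<mu>'"
      \<comment> \<open>A radius, at least 1, at which the lower bound for \<open>u 0\<close>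
        already reaches \<open>u 0 + 1\<close>.\<close>
      define t where "t = max 1 (((u 0 + 1) / c') powr (1 / - \<mu>'))"
      have "0 \<le> t" by (simp add: t_def)
      then obtain x :: "real ^ 'n" where x: "norm x = t"
        using vector_choose_size by blast
      have pos: "0 < (u 0 + 1) / c'" using c' u_nonneg[of 0] by (simp add: add_nonneg_pos)
      have "(u 0 + 1) / c' = (((u 0 + 1) / c') powr (1 / - \<mu>')) powr - \<mu>'"
        using neg by (simp add: powr_powr abs_of_nonneg[OF less_imp_le[OF pos]] del: abs_divide)
      also have "\<dots> \<le> t powr - \<mu>'"
        using neg by (intro powr_mono2) (auto simp: t_def)
      finally have "u 0 + 1 \<le> c' * t powr - \<mu>'"
        using c'(1) by (simp add: field_simps)
      moreover have "c' * norm x powr - \<mu>' \<le> u 0"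
        using c'(2)[rule_format, of x 0] x by (simp add: t_def)
      ultimately show False using x by simp
    qed
    moreover have "\<forall>x. 1 \<le> norm x \<longrightarrow> c' * norm x powr - \<mu>' \<le> u x"
      using c'(2) by blast
    ultimately show ?case using c'(1) by blast
  qed
  moreover obtain k where "\<mu>\<^sub>0 < real k * d"
    using ex_less_of_nat_mult[OF d(1)] by blast
  ultimately show False by (smt (verit))
qed

lemma subcritical_solution_eq_0:
  assumes "p < (real CARD('n) + \<gamma> + 2 * a) / (real CARD('n) - \<gamma>)"
  shows "u x = 0"
proof (rule ccontr)
  assume nz: "u x \<noteq> 0"
  have "p * q < real CARD('n) + \<gamma> + 2 * a"
    using assms gamma_less by (simp add: q_def field_simps)
  then have tau: "0 < \<tau>" by (simp add: \<tau>_def)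
  show False
  proof (cases "p \<le> 1")
    case True
    obtain c where c: "0 < c" "\<forall>x. c * (1 + norm x) powr (- q) \<le> u x"
      using u_lower_bound[OF nz] by blast
    have "c * 2 powr - q * norm x powr - q \<le> u x" if "1 \<le> norm x" for x
    proof -
      have "c * 2 powr - q * norm x powr - q = c * (2 * norm x) powr - q"
        by (simp add: powr_mult)
      also have "\<dots> \<le> c * (1 + norm x) powr - q"
        using that c(1) q_pos by (intro mult_left_mono powr_mono2') auto
      also have "\<dots> \<le> u x" using c(2) by blast
      finally show ?thesis .
    qed
    \<comment> \<open>For p at most 1 the power does not increase the exponent, so each step gains
      the full a + \<gamma>.\<close>
    moreover have "p * \<mu> - a - \<gamma> \<le> \<mu> - (a + \<gamma>)" if "0 \<le> \<mu>" for \<mu>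
      using mult_right_mono[OF True that] by simp
    moreover have "0 < c * 2 powr - q" "0 < a + \<gamma>"
      using c(1) a_nonneg gamma_pos by auto
    ultimately show False
      using no_slow_decay[of "c * 2 powr - q" q "a + \<gamma>"] q_pos by simp
  next
    case False
    then obtain c where c: "0 < c" "\<forall>z. 1 \<le> norm z \<longrightarrow> c * norm z powr - (q / 2) \<le> u z"
      using u_lower_bound_moving_spheres[OF nz tau] by auto
    \<comment> \<open>At \<mu> = q/2 the change (p - 1)\<mu> - a - \<gamma> equals -\<tau>/2, and
      for smaller \<mu> it is at most that because p > 1.\<close>
    have "p * \<mu> - a - \<gamma> \<le> \<mu> - \<tau> / 2" if "0 \<le> \<mu>" "\<mu> \<le> q / 2" for \<mu>
    proof -
      have "(p - 1) * \<mu> \<le> (p - 1) * (q / 2)"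
        using False that by (intro mult_left_mono) auto
      then show ?thesis by (simp add: \<tau>_def q_def field_simps)
    qed
    then show False
      using no_slow_decay[of c "q / 2" "\<tau> / 2"] c q_pos tau by simp
  qed
qed

end

theorem theorem1p10:
  fixes m :: nat and \<alpha> a p :: real and u :: "real ^ 'n::finite \<Rightarrow> real"
  assumes "m \<ge> 1"
    and "0 < \<alpha>" and "\<alpha> < 2"
    and "2 * real m + \<alpha> < real CARD('n)"
    and "a \<ge> 0"
    and "0 < p"
    and "p < (real CARD('n) + 2 * real m + \<alpha> + 2 * a) / (real CARD('n) - 2 * real m - \<alpha>)"
    and "continuous_on UNIV u"
    and "\<forall>x. u x \<ge> 0"
    and "riesz_integral_solution (2 * real m + \<alpha>) a p u"
  shows "\<forall>x. u x = 0"
proof -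
  interpret riesz_solution "2 * real m + \<alpha>" a p u
    by unfold_locales (use assms in auto)
  have "p < (real CARD('n) + (2 * real m + \<alpha>) + 2 * a) / (real CARD('n) - (2 * real m + \<alpha>))"
    using assms(7) by (simp add: algebra_simps)
  then show ?thesis using subcritical_solution_eq_0 by blast
qed

end
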